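(* Let $k\ge1$, $n\ge2$, and let $K_1,K_2\subset\mathbb{R}^k$ be fractal $k$-cubes of order $n$ with digit sets $D_1,D_2\subset\{0,1,\dots,n-1\}^k$. For $\alpha\in A_k=\{-1,0,1\}^k$ let $F_\alpha=K_1\cap(K_2+\alpha)$ and $G_\alpha=D_1\cap(D_2+(n-1)\alpha)$. Let $\alpha\in A_k$ with $F_\alpha\neq\varnothing$, and put $$\nu(\alpha)=\max\{\#G_\beta:\beta\succcurlyeq\alpha\},\qquad s(\alpha)=\log_n\nu(\alpha).$$ Then the Hausdorff dimension of $F_\alpha$ is $s(\alpha)$, and its $s(\alpha)$-dimensional Hausdorff measure $H^{s(\alpha)}(F_\alpha)$ is positive. Moreover, $H^{s(\alpha)}(F_\alpha)$ is finite if and only if the set $\{\beta\succcurlyeq\alpha:\#G_\beta=\nu(\alpha)\}$ does not contain two distinct $\Gamma$-comparable elements.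
   Context: A fractal $k$-cube of order $n$ with (nonempty) digit set $D\subset\{0,1,\dots,n-1\}^k$ is the unique nonempty compact set $K\subset\mathbb{R}^k$ with $K=\frac1n(K+D)$ (Minkowski sum). For $\alpha,\beta\in A_k=\{-1,0,1\}^k$, write $\alpha\sqsubseteq\beta$ if $\beta_i=\alpha_i$ for every coordinate $i$ with $\alpha_i\neq0$, and $\alpha\sqsubset\beta$ if moreover $\alpha\ne\beta$. For $\alpha\sqsubseteq\beta$ put $G_{\alpha\beta}=D_1\cap(D_2+n\alpha-\beta)$; in particular $G_{\alpha\alpha}=G_\alpha$. The structure graph $\Gamma$ is the directed graph whose vertices are the nonempty sets $F_\alpha$ (indexed by $\alpha\in A_k$), with an edge from $F_\alpha$ to $F_\beta$ whenever $\alpha\sqsubseteq\beta$, $G_{\alpha\beta}\ne\varnothing$ and $F_\beta\neq\varnothing$. Write $\beta\succ\alpha$ if there is a directed path in $\Gamma$ from $F_\alpha$ to $F_\beta$ with $\beta\neq\alpha$, i.e. a finite sequence $\alpha=\alpha_0\sqsubset\alpha_1\sqsubset\dots\sqsubset\alpha_p=\beta$ with $p\ge1$, all $F_{\alpha_j}\neq\varnothing$ and all $G_{\alpha_{j-1}\alpha_j}\ne\varnothing$. Write $\beta\succcurlyeq\alpha$ if $\beta=\alpha$ or $\beta\succ\alpha$. Elements $\alpha,\beta$ are $\Gamma$-comparable if $\beta\succcurlyeq\alpha$ or $\alpha\succcurlyeq\beta$. $H^s$ denotes $s$-dimensional Hausdorff measure on $\mathbb{R}^k$ ($H^0$ being counting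 measure). *)

theory Defs
  imports "HOL-Analysis.Analysis"
begin

section \<open>Hausdorff measure and Hausdorff dimension\<close>

text \<open>
  The usual convention is \<open>diam U ^ 0 = 1\<close> for every nonempty \<open>U\<close>, so that \<open>H^0\<close> is counting
  measure. Since \<open>0 powr 0 = 0\<close> in HOL, the exponent 0 needs its own case.
\<close>

definition diam_powr :: "real \<Rightarrow> 'a::metric_space set \<Rightarrow> real" where
  "diam_powr s U = (if U = {} then 0 else if s = 0 then 1 else diameter U powr s)"

text \<open>
  \<^const>\<open>diameter\<close> is real-valued and meaningful only on bounded sets, hence the explicit
  boundedness condition. Covers by finitely many sets are included, as members may be empty.
\<close>

definition delta_cover :: "real \<Rightarrow> 'a::metric_space set \<Rightarrow> (nat \<Rightarrow> 'a set) \<Rightarrow> bool" where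
  "delta_cover \<delta> S U \<longleftrightarrow> S \<subseteq> (\<Union>i. U i) \<and> (\<forall>i. bounded (U i) \<and> diameter (U i) \<le> \<delta>)"

definition hausdorff_premeasure :: "real \<Rightarrow> real \<Rightarrow> 'a::metric_space set \<Rightarrow> ennreal" where
  "hausdorff_premeasure s \<delta> S = (INF U\<in>{U. delta_cover \<delta> S U}. \<Sum>i. ennreal (diam_powr s (U i)))"

definition hausdorff_measure :: "real \<Rightarrow> 'a::metric_space set \<Rightarrow> ennreal" where
  "hausdorff_measure s S = (SUP \<delta>\<in>{0<..}. hausdorff_premeasure s \<delta> S)"

definition hausdorff_dim :: "'a::metric_space set \<Rightarrow> ereal" where
  "hausdorff_dim S = (INF s\<in>{s. 0 \<le> s \<and> hausdorff_measure s S = 0}. ereal s)"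


section \<open>Fractal cubes\<close>

definition real_vec :: "int ^ 'k \<Rightarrow> real ^ 'k" where
  "real_vec v = (\<chi> i. real_of_int (v $ i))"

definition digit_cube :: "nat \<Rightarrow> (int ^ 'k) set" where
  "digit_cube n = {d. \<forall>i. d $ i \<in> {0..int n - 1}}"

text \<open>
  For \<open>n \<ge> 2\<close> and finite nonempty \<open>D\<close>, exactly one set satisfies this predicate (Hutchinson).
\<close>

definition is_fractal_cube :: "nat \<Rightarrow> (int ^ 'k) set \<Rightarrow> (real ^ 'k) set \<Rightarrow> bool" where
  "is_fractal_cube n D K \<longleftrightarrow>
     compact K \<and> K \<noteq> {} \<and> K = {(1 / real n) *\<^sub>R (x + real_vec d) | x d. x \<in> K \<and> d \<in> D}"


section \<open>Intersections of translates and the structure graph\<close>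

definition sign_vectors :: "(int ^ 'k) set" where
  "sign_vectors = {\<alpha>. \<forall>i. \<alpha> $ i \<in> {-1, 0, 1}}"

definition sign_le :: "int ^ 'k \<Rightarrow> int ^ 'k \<Rightarrow> bool" where
  "sign_le \<alpha> \<beta> \<longleftrightarrow> (\<forall>i. \<alpha> $ i \<noteq> 0 \<longrightarrow> \<beta> $ i = \<alpha> $ i)"

definition F_set :: "(real ^ 'k) set \<Rightarrow> (real ^ 'k) set \<Rightarrow> int ^ 'k \<Rightarrow> (real ^ 'k) set" where
  "F_set K1 K2 \<alpha> = K1 \<inter> {x + real_vec \<alpha> | x. x \<in> K2}"

definition G_set :: "nat \<Rightarrow> (int ^ 'k) set \<Rightarrow> (int ^ 'k) set \<Rightarrow> int ^ 'k \<Rightarrow> (int ^ 'k) set" where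
  "G_set n D1 D2 \<alpha> = D1 \<inter> {d + (int n - 1) *s \<alpha> | d. d \<in> D2}"

definition G_pair ::
  "nat \<Rightarrow> (int ^ 'k) set \<Rightarrow> (int ^ 'k) set \<Rightarrow> int ^ 'k \<Rightarrow> int ^ 'k \<Rightarrow> (int ^ 'k) set" where
  "G_pair n D1 D2 \<alpha> \<beta> = D1 \<inter> {d + int n *s \<alpha> - \<beta> | d. d \<in> D2}"

lemma G_pair_same: "G_pair n D1 D2 \<alpha> \<alpha> = G_set n D1 D2 \<alpha>"
proof -
  have "d + int n *s \<alpha> - \<alpha> = d + (int n - 1) *s \<alpha>" for d :: "int ^ 'a"
    by (simp add: vec_eq_iff algebra_simps)
  then show ?thesis
    by (simp only: G_pair_def G_set_def)
qed

text \<open>Vertices \<open>F_\<alpha>\<close> are represented by their indices; loops are edges as well.\<close>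

definition structure_edge ::
  "nat \<Rightarrow> (int ^ 'k) set \<Rightarrow> (int ^ 'k) set \<Rightarrow> (real ^ 'k) set \<Rightarrow> (real ^ 'k) set
    \<Rightarrow> int ^ 'k \<Rightarrow> int ^ 'k \<Rightarrow> bool" where
  "structure_edge n D1 D2 K1 K2 \<alpha> \<beta> \<longleftrightarrow>
     \<alpha> \<in> sign_vectors \<and> \<beta> \<in> sign_vectors \<and>
     F_set K1 K2 \<alpha> \<noteq> {} \<and> F_set K1 K2 \<beta> \<noteq> {} \<and>
     sign_le \<alpha> \<beta> \<and> G_pair n D1 D2 \<alpha> \<beta> \<noteq> {}"

text \<open>
  \<open>structure_less n D1 D2 K1 K2 \<alpha> \<beta>\<close> means \<open>\<beta> \<succ> \<alpha>\<close>: there is a chain of at least one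
  non-loop edge from \<open>\<alpha>\<close> to \<open>\<beta>\<close>.
\<close>

definition structure_less ::
  "nat \<Rightarrow> (int ^ 'k) set \<Rightarrow> (int ^ 'k) set \<Rightarrow> (real ^ 'k) set \<Rightarrow> (real ^ 'k) set
    \<Rightarrow> int ^ 'k \<Rightarrow> int ^ 'k \<Rightarrow> bool" where
  "structure_less n D1 D2 K1 K2 = (\<lambda>\<alpha> \<beta>. structure_edge n D1 D2 K1 K2 \<alpha> \<beta> \<and> \<alpha> \<noteq> \<beta>)\<^sup>+\<^sup>+"

definition structure_le ::
  "nat \<Rightarrow> (int ^ 'k) set \<Rightarrow> (int ^ 'k) set \<Rightarrow> (real ^ 'k) set \<Rightarrow> (real ^ 'k) set
    \<Rightarrow> int ^ 'k \<Rightarrow> int ^ 'k \<Rightarrow> bool" where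
  "structure_le n D1 D2 K1 K2 \<alpha> \<beta> \<longleftrightarrow> \<beta> = \<alpha> \<or> structure_less n D1 D2 K1 K2 \<alpha> \<beta>"

definition structure_comparable ::
  "nat \<Rightarrow> (int ^ 'k) set \<Rightarrow> (int ^ 'k) set \<Rightarrow> (real ^ 'k) set \<Rightarrow> (real ^ 'k) set
    \<Rightarrow> int ^ 'k \<Rightarrow> int ^ 'k \<Rightarrow> bool" where
  "structure_comparable n D1 D2 K1 K2 \<alpha> \<beta> \<longleftrightarrow>
     structure_le n D1 D2 K1 K2 \<alpha> \<beta> \<or> structure_le n D1 D2 K1 K2 \<beta> \<alpha>"

definition nu ::
  "nat \<Rightarrow> (int ^ 'k) set \<Rightarrow> (int ^ 'k) set \<Rightarrow> (real ^ 'k) set \<Rightarrow> (real ^ 'k) set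
    \<Rightarrow> int ^ 'k \<Rightarrow> nat" where
  "nu n D1 D2 K1 K2 \<alpha> = Max {card (G_set n D1 D2 \<beta>) | \<beta>. structure_le n D1 D2 K1 K2 \<alpha> \<beta>}"

definition s_exponent ::
  "nat \<Rightarrow> (int ^ 'k) set \<Rightarrow> (int ^ 'k) set \<Rightarrow> (real ^ 'k) set \<Rightarrow> (real ^ 'k) set
    \<Rightarrow> int ^ 'k \<Rightarrow> real" where
  "s_exponent n D1 D2 K1 K2 \<alpha> = log (real n) (real (nu n D1 D2 K1 K2 \<alpha>))"

end

theory Submission
  imports Defs
begin

text \<open>
  The sets \<open>F \<alpha>\<close> form a graph-directed system: \<open>F \<alpha>\<close> is the union over the edges from \<open>\<alpha>\<close> to \<open>\<beta>\<close>
  of \<open>(F \<beta> + G \<alpha> \<beta>) / n\<close>, and apart from loops the graph is acyclic, since along an edge zero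
  coordinates can only become nonzero. A triangular transfer matrix then has the largest diagonal entry
  \<open>\<nu>\<close> as growth rate of the number of paths, and the growth is exactly of order \<open>\<nu> ^ m\<close> if no path
  passes through two vertices with \<open>\<nu>\<close> loops; covering \<open>F \<alpha>\<close> by the cubes of the paths gives the
  upper bounds.

  For the lower bounds mass is distributed evenly over the points whose path loops at a vertex with \<open>\<nu>\<close>
  loops. If a path passes through two such vertices \<open>\<beta>\<close> and \<open>\<gamma>\<close>, then for every \<open>j\<close> the points that
  loop \<open>j\<close> times at \<open>\<beta>\<close> and afterwards at \<open>\<gamma>\<close> carry the same mass. The exact power of \<open>n\<close> in the
  denominator of a suitable coordinate determines \<open>j\<close>, so these pieces are disjoint and the measure is
  infinite.
\<close>

section \<open>Estimates for Hausdorff measures\<close>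

lemma diam_powr_le:
  assumes "bounded U" "diameter U \<le> r" "0 < r" "0 \<le> s"
  shows "diam_powr s U \<le> r powr s"
  using assms diameter_ge_0[OF assms(1)] by (auto simp: diam_powr_def intro!: powr_mono2)

lemma diam_powr_nonneg: "0 \<le> diam_powr s U"
  by (simp add: diam_powr_def)

lemma hausdorff_premeasure_antimono:
  assumes "\<delta> \<le> \<delta>'"
  shows "hausdorff_premeasure s \<delta>' S \<le> hausdorff_premeasure s \<delta> S"
  unfolding hausdorff_premeasure_def
proof (rule INF_superset_mono)
  have "diameter U \<le> \<delta>'" if "diameter U \<le> \<delta>" for U :: "'a set"
    using that assms by (rule order_trans)
  then show "{U. delta_cover \<delta> S U} \<subseteq> {U. delta_cover \<delta>' S U}"
    by (simp add: delta_cover_def Collect_mono)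
qed simp

lemma hausdorff_measure_ge_premeasure:
  "0 < \<delta> \<Longrightarrow> hausdorff_premeasure s \<delta> S \<le> hausdorff_measure s S"
  unfolding hausdorff_measure_def by (rule SUP_upper) auto

lemma hausdorff_measure_zero_mono:
  assumes "0 \<le> t" "t \<le> s" "hausdorff_measure t S = 0"
  shows "hausdorff_measure s S = 0"
proof -
  have "hausdorff_premeasure s \<delta> S \<le> 0" if "\<delta> > 0" for \<delta>
  proof -
    have le: "diam_powr s U \<le> diam_powr t U" if "bounded U" "diameter U \<le> 1" for U :: "'a set"
      using that assms(1,2) diameter_ge_0[OF that(1)]
      by (auto simp: diam_powr_def powr_le1 intro: powr_mono')
    \<comment> \<open>At diameters up to 1 a larger exponent cannot increase
      \<open>diam_powr\<close>, so the scale is first cut to \<open>min \<delta> 1\<close>.\<close>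
    have "hausdorff_premeasure s \<delta> S \<le> hausdorff_premeasure s (min \<delta> 1) S"
      by (rule hausdorff_premeasure_antimono) auto
    also have "\<dots> \<le> hausdorff_premeasure t (min \<delta> 1) S"
      unfolding hausdorff_premeasure_def
    proof (rule INF_superset_mono)
      fix U :: "nat \<Rightarrow> 'a set" assume "U \<in> {U. delta_cover (min \<delta> 1) S U}"
      then show "(\<Sum>i. ennreal (diam_powr s (U i))) \<le> (\<Sum>i. ennreal (diam_powr t (U i)))"
        by (intro suminf_le ennreal_leI le) (auto simp: delta_cover_def)
    qed simp
    also have "\<dots> \<le> hausdorff_measure t S"
      by (rule hausdorff_measure_ge_premeasure) (use that in auto)
    finally show ?thesis using assms by simp
  qed
  then show ?thesis
    unfolding hausdorff_measure_def by (simp add: SUP_eq_iff)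
qed

text \<open>Positivity at \<open>s\<close> keeps every t \<le> s out of the infimum, by
  \<open>hausdorff_measure_zero_mono\<close>. The measure at \<open>s\<close> itself does not
  vanish, so the upper bound is approached through exponents s + r.\<close>

lemma hausdorff_dim_eqI:
  assumes "0 \<le> s" "hausdorff_measure s S > 0" "\<And>t. t > s \<Longrightarrow> hausdorff_measure t S = 0"
  shows "hausdorff_dim S = ereal s"
proof (rule antisym)
  show "ereal s \<le> hausdorff_dim S"
    unfolding hausdorff_dim_def
  proof (rule INF_greatest)
    fix t assume "t \<in> {s. 0 \<le> s \<and> hausdorff_measure s S = 0}"
    then have "\<not> t \<le> s" using hausdorff_measure_zero_mono[of t s S] assms(2) by auto
    then show "ereal s \<le> ereal t" by simp
  qed
  show "hausdorff_dim S \<le> ereal s"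
  proof (rule ereal_le_epsilon)
    fix e :: ereal assume "0 < e"
    show "hausdorff_dim S \<le> ereal s + e"
    proof (cases e)
      case (real r)
      with \<open>0 < e\<close> have "r > 0" by simp
      then have "hausdorff_dim S \<le> ereal (s + r)"
        unfolding hausdorff_dim_def by (intro INF_lower) (use assms in auto)
      then show ?thesis using real by simp
    qed (use \<open>0 < e\<close> in auto)
  qed
qed

section \<open>Upper bounds from finite covers of uniform size\<close>

text \<open>Counting sets is enough because all pieces of one generation obey the same size bound.
  \<open>N\<close> only bounds their number, so coinciding pieces do no harm.\<close>

definition covered_by :: "'a::metric_space set \<Rightarrow> nat \<Rightarrow> real \<Rightarrow> bool" where
  "covered_by S N r \<longleftrightarrow>
     (\<exists>\<U>. finite \<U> \<and> card \<U> \<le> N \<and> S \<subseteq> \<Union>\<U> \<and> (\<forall>U\<in>\<U>. bounded U \<and> diameter U \<le> r))"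

lemma covered_by_UN:
  assumes "finite I" "\<And>i. i \<in> I \<Longrightarrow> covered_by (S i) (N i) r"
  shows "covered_by (\<Union>i\<in>I. S i) (\<Sum>i\<in>I. N i) r"
proof -
  obtain \<U> where U: "\<And>i. i \<in> I \<Longrightarrow> finite (\<U> i) \<and> card (\<U> i) \<le> N i \<and> S i \<subseteq> \<Union>(\<U> i) \<and>
      (\<forall>U\<in>\<U> i. bounded U \<and> diameter U \<le> r)"
    using assms(2) unfolding covered_by_def by metis
  have "S i \<subseteq> \<Union>(\<Union>i\<in>I. \<U> i)" if "i \<in> I" for i
    using U[OF that] that by blast
  then have sub: "(\<Union>i\<in>I. S i) \<subseteq> \<Union>(\<Union>i\<in>I. \<U> i)" by (rule UN_least)
  have "card (\<Union>i\<in>I. \<U> i) \<le> (\<Sum>i\<in>I. card (\<U> i))"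
    by (rule card_UN_le[OF assms(1)])
  also have "\<dots> \<le> (\<Sum>i\<in>I. N i)" by (rule sum_mono) (use U in auto)
  finally have "card (\<Union>i\<in>I. \<U> i) \<le> (\<Sum>i\<in>I. N i)" .
  moreover have "finite (\<Union>i\<in>I. \<U> i)" using assms(1) U by blast
  moreover note sub
  moreover have "\<forall>V\<in>(\<Union>i\<in>I. \<U> i). bounded V \<and> diameter V \<le> r" using U by blast
  ultimately show ?thesis unfolding covered_by_def by (intro exI[of _ "\<Union>i\<in>I. \<U> i"]) simp
qed

lemma covered_by_Un:
  assumes "covered_by S M r" "covered_by T N r"
  shows "covered_by (S \<union> T) (M + N) r"
  using covered_by_UN[of "UNIV :: bool set" "\<lambda>b. if b then S else T" "\<lambda>b. if b then M else N" r] assms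
  by (simp add: UNIV_bool Un_commute add.commute)

lemma covered_by_subset: "covered_by T N r \<Longrightarrow> S \<subseteq> T \<Longrightarrow> covered_by S N r"
  unfolding covered_by_def by blast

lemma covered_by_image:
  assumes "covered_by S N r" "0 \<le> c" "0 \<le> r" and f: "\<And>x y. dist (f x) (f y) \<le> c * dist x y"
  shows "covered_by (f ` S) N (c * r)"
proof -
  obtain \<U> where U: "finite \<U>" "card \<U> \<le> N" "S \<subseteq> \<Union>\<U>"
      and b: "\<And>U. U \<in> \<U> \<Longrightarrow> bounded U" "\<And>U. U \<in> \<U> \<Longrightarrow> diameter U \<le> r"
    using assms(1) unfolding covered_by_def by auto
  have d: "dist (f x) (f y) \<le> c * r" if "U \<in> \<U>" "x \<in> U" "y \<in> U" for U x y
    using mult_left_mono[OF order_trans[OF diameter_bounded_bound[OF b(1) that(2,3)] b(2)] assms(2)]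
      f[of x y] that(1) by linarith
  have "bounded (f ` U)" if "U \<in> \<U>" for U
    unfolding bounded_two_points using d[OF that] by blast
  \<comment> \<open>The empty image has diameter 0 by convention; this is where 0 \<le> r
    enters.\<close>
  moreover have "diameter (f ` U) \<le> c * r" if "U \<in> \<U>" for U
    unfolding diameter_def using d[OF that] assms(2,3) by (auto intro!: cSUP_least)
  ultimately show ?thesis
    unfolding covered_by_def using U order_trans[OF card_image_le[OF U(1), of "image f"] U(2)]
    by (intro exI[of _ "image f ` \<U>"] conjI) (auto simp flip: image_Union intro!: image_mono)
qed

lemma hausdorff_premeasure_le:
  assumes "covered_by S N r" "0 < r" "r \<le> \<delta>" "0 \<le> s"
  shows "hausdorff_premeasure s \<delta> S \<le> ennreal (N * r powr s)"
proof -
  obtain \<U> where U: "finite \<U>" "card \<U> \<le> N" "S \<subseteq> \<Union>\<U>"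
      and b: "\<And>U. U \<in> \<U> \<Longrightarrow> bounded U" "\<And>U. U \<in> \<U> \<Longrightarrow> diameter U \<le> r"
    using assms(1) unfolding covered_by_def by auto
  obtain f :: "nat \<Rightarrow> 'a set" where f: "bij_betw f {..<card \<U>} \<U>"
    using ex_bij_betw_nat_finite[OF U(1)] unfolding atLeast0LessThan by blast
  \<comment> \<open>Empty sets fill up the sequence; they weigh 0 even for exponent 0.\<close>
  define V where "V = (\<lambda>i. if i < card \<U> then f i else {})"
  have V: "f i \<in> \<U>" if "i < card \<U>" for i using f that unfolding bij_betw_def by auto
  have "S \<subseteq> (\<Union>i. V i)"
  proof
    fix x assume "x \<in> S"
    with U(3) obtain W where "W \<in> \<U>" "x \<in> W" by blast
    moreover have "\<U> = f ` {..<card \<U>}" using f by (simp add: bij_betw_def)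
    ultimately obtain i where "i < card \<U>" "x \<in> f i" by blast
    then have "x \<in> V i" by (simp add: V_def)
    then show "x \<in> (\<Union>i. V i)" by blast
  qed
  then have "delta_cover \<delta> S V"
    using V b assms order_trans[OF b(2) \<open>r \<le> \<delta>\<close>] by (simp add: delta_cover_def V_def)
  then have "hausdorff_premeasure s \<delta> S \<le> (\<Sum>i. ennreal (diam_powr s (V i)))"
    unfolding hausdorff_premeasure_def by (intro INF_lower) auto
  also have "\<dots> = (\<Sum>i<card \<U>. ennreal (diam_powr s (V i)))"
    by (rule suminf_finite) (auto simp: V_def diam_powr_def)
  also have "\<dots> \<le> (\<Sum>i<card \<U>. ennreal (r powr s))"
    by (intro sum_mono ennreal_leI diam_powr_le) (use V b assms in \<open>auto simp: V_def\<close>)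
  also have "\<dots> = ennreal (card \<U> * r powr s)"
    by (simp add: ennreal_mult ennreal_of_nat_eq_real_of_nat)
  also have "\<dots> \<le> ennreal (N * r powr s)"
    by (intro ennreal_leI mult_right_mono) (use U in auto)
  finally show ?thesis .
qed

text \<open>For fixed \<delta> all covers with large \<open>m\<close> are fine enough, so the limit
  bounds each premeasure. A constant \<open>c\<close> gives finiteness, a null sequence gives
  measure zero.\<close>

lemma hausdorff_measure_le_of_covers:
  assumes "0 \<le> s" and cov: "\<And>m. covered_by S (N m) (r m)" "\<And>m. 0 < r m" "r \<longlonglongrightarrow> 0"
    and le: "\<And>m. N m * r m powr s \<le> c m" and c: "c \<longlonglongrightarrow> l"
  shows "hausdorff_measure s S \<le> ennreal l"
  unfolding hausdorff_measure_def
proof (rule SUP_least)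
  fix \<delta> :: real assume "\<delta> \<in> {0<..}"
  then have "\<forall>\<^sub>F m in sequentially. r m < \<delta>"
    using order_tendstoD(2)[OF cov(3)] by auto
  then have "\<forall>\<^sub>F m in sequentially. hausdorff_premeasure s \<delta> S \<le> ennreal (c m)"
  proof eventually_elim
    case (elim m)
    then have "hausdorff_premeasure s \<delta> S \<le> ennreal (N m * r m powr s)"
      by (intro hausdorff_premeasure_le cov assms(1)) auto
    also have "\<dots> \<le> ennreal (c m)" by (intro ennreal_leI le)
    finally show ?case .
  qed
  with tendsto_ennrealI[OF c] show "hausdorff_premeasure s \<delta> S \<le> ennreal l"
    by (rule tendsto_lowerbound) auto
qed

section \<open>Lower bounds from evenly distributed mass\<close>

text \<open>Open sets allow the passage to a finite subcover. Right continuity of the power function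
  leaves room above the diameter, and \<open>r\<close> is positive even if \<open>U\<close> is a
  single point.\<close>

lemma open_enlargement:
  fixes U :: "'a::metric_space set"
  assumes "bounded U" "U \<noteq> {}" "diameter U < \<delta>" "0 \<le> s" "0 < e"
  obtains V r where "open V" "U \<subseteq> V" "bounded V" "diameter V \<le> r" "0 < r" "r < \<delta>"
    "r powr s \<le> diam_powr s U + e"
proof -
  have d0: "0 \<le> diameter U" by (rule diameter_ge_0[OF assms(1)])
  have "\<exists>r>diameter U. r < \<delta> \<and> r powr s \<le> diam_powr s U + e"
  proof (cases "s = 0")
    case True
    obtain r where "diameter U < r" "r < \<delta>" using dense assms(3) by blast
    then show ?thesis using True d0 assms by (intro exI[of _ r]) (auto simp: diam_powr_def)
  next
    case False
    have "((\<lambda>x. x powr s) \<longlongrightarrow> diameter U powr s) (at_right (diameter U))"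
      using d0 False assms(4)
      by (intro tendsto_powr' tendsto_intros) (auto simp: eventually_at_right_less
          intro: eventually_mono[OF eventually_at_right_less])
    then have "\<forall>\<^sub>F x in at_right (diameter U). x powr s < diameter U powr s + e"
      by (rule order_tendstoD) (use assms in auto)
    moreover have "\<forall>\<^sub>F x in at_right (diameter U). x < \<delta>"
      using assms(3) eventually_at_right_field by blast
    ultimately have "\<forall>\<^sub>F x in at_right (diameter U).
        x > diameter U \<and> x < \<delta> \<and> x powr s < diameter U powr s + e"
      using eventually_at_right_less by eventually_elim auto
    then obtain x where "x > diameter U \<and> x < \<delta> \<and> x powr s < diameter U powr s + e"
      using eventually_happens trivial_limit_at_right_real by blast
    then show ?thesis using False assms(2) by (intro exI[of _ x]) (auto simp: diam_powr_def)
  qed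
  then obtain r where r: "diameter U < r" "r < \<delta>" "r powr s \<le> diam_powr s U + e" by blast
  \<comment> \<open>Enlarging by \<eta> at both ends of a distance uses up exactly the slack
    \<open>r - diameter U\<close>.\<close>
  define \<eta> where "\<eta> = (r - diameter U) / 2"
  define V where "V = (\<Union>x\<in>U. ball x \<eta>)"
  have "\<eta> > 0" using r by (simp add: \<eta>_def)
  have dV: "dist y z \<le> r" if yz: "y \<in> V" "z \<in> V" for y z
  proof -
    obtain a b where ab: "a \<in> U" "b \<in> U" "dist a y < \<eta>" "dist b z < \<eta>"
      using yz by (auto simp: V_def)
    have "dist y z \<le> dist a y + dist a b + dist b z"
      using dist_triangle[of y z a] dist_triangle[of a z b] by (simp add: dist_commute)
    moreover have "dist a b \<le> diameter U" by (rule diameter_bounded_bound[OF assms(1) ab(1,2)])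
    moreover have "\<eta> + diameter U + \<eta> = r" by (simp add: \<eta>_def)
    ultimately show ?thesis using ab by linarith
  qed
  have "open V" by (auto simp: V_def)
  moreover have "U \<subseteq> V" using \<open>\<eta> > 0\<close> by (auto simp: V_def)
  moreover have "bounded V" unfolding bounded_two_points using dV by blast
  moreover have "diameter V \<le> r"
    unfolding diameter_def using dV r d0 by (auto intro!: cSUP_least)
  ultimately show thesis using r d0 by (intro that[of V r]) auto
qed

text \<open>A discrete mass distribution principle: by compactness only finitely many members of a cover
  matter, so it suffices to distribute mass over finitely many points at a sufficiently fine scale.\<close>

lemma hausdorff_premeasure_ge:
  fixes S :: "'a::metric_space set"
  assumes S: "compact S" and \<delta>: "0 < \<delta>" "\<delta> \<le> 1" and n: "1 < n" and s: "0 \<le> s" and C: "0 < C"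
    and X: "\<And>L. L \<ge> L0 \<Longrightarrow> \<exists>X\<subseteq>S. finite X \<and> A * (n powr s) ^ L \<le> card X \<and>
      (\<forall>U m. bounded U \<longrightarrow> diameter U < \<delta> \<longrightarrow> m \<le> L \<longrightarrow> diameter U \<le> (1 / n) ^ m \<longrightarrow>
         card (X \<inter> U) \<le> C * (n powr s) ^ (L - m))"
  shows "ennreal (A / (C * n powr s)) \<le> hausdorff_premeasure s (\<delta> / 2) S"
  unfolding hausdorff_premeasure_def
proof (rule INF_greatest, rule ennreal_le_epsilon)
  fix U :: "nat \<Rightarrow> 'a set" and e :: real
  assume U: "U \<in> {U. delta_cover (\<delta> / 2) S U}" and e: "0 < e"
  let ?\<nu> = "n powr s"
  have \<nu>: "?\<nu> > 0" using n by simp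
  \<comment> \<open>The tolerances sum to \<open>e\<close>, whatever the number of sets.\<close>
  define e' where "e' = (\<lambda>i::nat. e * (1 / 2) ^ Suc i)"
  have "\<exists>V r. open V \<and> U i \<subseteq> V \<and> bounded V \<and> diameter V \<le> r \<and> 0 < r \<and> r < \<delta> \<and>
      r powr s \<le> diam_powr s (U i) + e' i" if "U i \<noteq> {}" for i
  proof -
    have "bounded (U i)" "diameter (U i) < \<delta>"
      using U \<delta> by (auto simp: delta_cover_def intro: le_less_trans[of _ "\<delta>/2"])
    then show ?thesis
      using open_enlargement[of "U i" \<delta> s "e' i"] that s e by (simp add: e'_def) metis
  qed
  then obtain V r where V: "\<And>i. U i \<noteq> {} \<Longrightarrow> open (V i) \<and> U i \<subseteq> V i \<and> bounded (V i) \<and>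
      diameter (V i) \<le> r i \<and> 0 < r i \<and> r i < \<delta> \<and> r i powr s \<le> diam_powr s (U i) + e' i"
    by metis
  have "S \<subseteq> (\<Union>i\<in>{i. U i \<noteq> {}}. V i)"
  proof
    fix x assume "x \<in> S"
    then obtain i where i: "x \<in> U i" using U by (auto simp: delta_cover_def)
    then have "U i \<noteq> {}" by blast
    with V[OF this] i show "x \<in> (\<Union>i\<in>{i. U i \<noteq> {}}. V i)" by blast
  qed
  then obtain I where I: "I \<subseteq> {i. U i \<noteq> {}}" "finite I" "S \<subseteq> (\<Union>i\<in>I. V i)"
    using compactE_image[OF S, of "{i. U i \<noteq> {}}" V] V by blast
  have "\<forall>\<^sub>F L in sequentially. (1 / n) ^ L < r i" if "i \<in> I" for i
  proof -
    have "0 < r i" using V[of i] that I(1) by blast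
    then show ?thesis
      using order_tendstoD(2)[OF LIMSEQ_realpow_zero[of "1/n"]] n by auto
  qed
  then have "\<forall>\<^sub>F L in sequentially. \<forall>i\<in>I. (1 / n) ^ L < r i"
    using I(2) by (simp add: eventually_ball_finite)
  with eventually_ge_at_top[of L0] have "\<forall>\<^sub>F L in sequentially. L0 \<le> L \<and> (\<forall>i\<in>I. (1 / n) ^ L < r i)"
    by (rule eventually_conj)
  from eventually_happens[OF this]
  obtain L where L: "L \<ge> L0" "\<And>i. i \<in> I \<Longrightarrow> (1 / n) ^ L < r i" by auto
  obtain X where X': "X \<subseteq> S" "finite X" "A * ?\<nu> ^ L \<le> card X"
    and XU: "\<And>U m. bounded U \<Longrightarrow> diameter U < \<delta> \<Longrightarrow> m \<le> L \<Longrightarrow> diameter U \<le> (1 / n) ^ m \<Longrightarrow>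
         card (X \<inter> U) \<le> C * ?\<nu> ^ (L - m)"
    using X[OF L(1)] by blast
  have card_V: "card (X \<inter> V i) \<le> C * ?\<nu> ^ L * ?\<nu> * r i powr s" if i: "i \<in> I" for i
  proof -
    have "U i \<noteq> {}" using i I(1) by blast
    from V[OF this] have ri: "diameter (V i) \<le> r i" "0 < r i" "r i < \<delta>" "bounded (V i)"
      by simp_all
    \<comment> \<open>This \<open>m\<close> is the generation of \<open>V i\<close>:
      \<open>r i\<close> lies above \<open>(1 / n) ^ Suc m\<close> and not above
      \<open>(1 / n) ^ m\<close>. For m = 0 the upper bound comes from \<open>r i < \<delta>\<close>
      and \<delta> \<le> 1.\<close>
    define m where "m = (LEAST m. (1 / n) ^ Suc m < r i)"
    have "L \<noteq> 0" using L(2)[OF i] ri \<delta> by (cases L) auto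
    then have ex: "(1 / n) ^ Suc (L - 1) < r i" using L(2)[OF i] by simp
    have m1: "(1 / n) ^ Suc m < r i" unfolding m_def by (rule LeastI[of _ "L - 1"]) (rule ex)
    have m2: "m \<le> L" unfolding m_def using Least_le[where P="\<lambda>m. (1 / n) ^ Suc m < r i", OF ex] by simp
    have m3: "r i \<le> (1 / n) ^ m"
    proof (cases m)
      case 0 then show ?thesis using ri \<delta> by simp
    next
      case (Suc k)
      then show ?thesis using not_less_Least[of k "\<lambda>m. (1 / n) ^ Suc m < r i"] m_def by simp
    qed
    have "card (X \<inter> V i) \<le> C * ?\<nu> ^ (L - m)"
      using ri m2 m3 by (intro XU) auto
    \<comment> \<open>Since \<open>r i\<close> is known only up to a factor \<open>n\<close>, one
      factor \<open>n powr s\<close> is lost; it reappears in the denominator of the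
      conclusion.\<close>
    also have "\<dots> = C * ?\<nu> ^ L * ?\<nu> * ((1 / n) ^ Suc m) powr s"
    proof -
      let ?p = "((1 / n) ^ Suc m) powr s"
      have p: "?p * ?\<nu> ^ Suc m = 1"
        using n by (simp add: powr_mult powr_divide power_one_over powr_power powr_realpow[symmetric] powr_powr mult.commute flip: power_Suc)
      have "?\<nu> ^ L = ?\<nu> ^ (L - m) * ?\<nu> ^ m" using m2 by (simp flip: power_add)
      then have "?\<nu> ^ L * ?\<nu> * ?p = ?\<nu> ^ (L - m) * (?p * ?\<nu> ^ Suc m)"
        by (simp add: algebra_simps)
      then have "?\<nu> ^ L * ?\<nu> * ?p = ?\<nu> ^ (L - m)"
        unfolding p by simp
      then show ?thesis by (simp only: mult.assoc)
    qed
    also have "\<dots> \<le> C * ?\<nu> ^ L * ?\<nu> * r i powr s"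
      using m1 s C \<nu> n by (intro mult_left_mono powr_mono2) auto
    finally show ?thesis .
  qed
  have "X = (\<Union>i\<in>I. X \<inter> V i)" using X'(1) I(3) by blast
  then have "A * ?\<nu> ^ L \<le> card (\<Union>i\<in>I. X \<inter> V i)" using X'(3) by simp
  also have "\<dots> \<le> (\<Sum>i\<in>I. real (card (X \<inter> V i)))"
    using card_UN_le[OF I(2), of "\<lambda>i. X \<inter> V i"] by (metis of_nat_le_iff of_nat_sum)
  also have "\<dots> \<le> (\<Sum>i\<in>I. C * ?\<nu> ^ L * ?\<nu> * r i powr s)"
    by (rule sum_mono) (rule card_V)
  also have "\<dots> = ?\<nu> ^ L * (C * ?\<nu> * (\<Sum>i\<in>I. r i powr s))"
    by (simp add: sum_distrib_left algebra_simps)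
  finally have "?\<nu> ^ L * A \<le> ?\<nu> ^ L * (C * ?\<nu> * (\<Sum>i\<in>I. r i powr s))" by (simp add: mult.commute)
  then have "A \<le> C * ?\<nu> * (\<Sum>i\<in>I. r i powr s)"
    using \<nu> by (metis mult_le_cancel_left_pos zero_less_power)
  then have "A / (C * ?\<nu>) \<le> (\<Sum>i\<in>I. r i powr s)"
    using C \<nu> by (simp add: divide_le_eq mult.commute)
  also have "\<dots> \<le> (\<Sum>i\<in>I. diam_powr s (U i) + e' i)"
  proof (rule sum_mono)
    fix i assume "i \<in> I"
    then have "U i \<noteq> {}" using I(1) by blast
    from V[OF this] show "r i powr s \<le> diam_powr s (U i) + e' i" by simp
  qed
  also have "\<dots> = (\<Sum>i\<in>I. diam_powr s (U i)) + (\<Sum>i\<in>I. e' i)" by (rule sum.distrib)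
  also have "(\<Sum>i\<in>I. e' i) \<le> e"
  proof -
    have "e' sums (e * 1)" unfolding e'_def by (intro sums_mult power_half_series)
    then show ?thesis using I(2) e sum_le_suminf[of e' I] by (auto simp: sums_iff e'_def)
  qed
  finally have "ennreal (A / (C * ?\<nu>)) \<le> ennreal ((\<Sum>i\<in>I. diam_powr s (U i)) + e)"
    by (simp add: ennreal_leI)
  also have "\<dots> = (\<Sum>i\<in>I. ennreal (diam_powr s (U i))) + ennreal e"
    using e by (simp add: sum_nonneg diam_powr_nonneg sum_ennreal)
  also have "(\<Sum>i\<in>I. ennreal (diam_powr s (U i))) \<le> (\<Sum>i. ennreal (diam_powr s (U i)))"
    by (rule sum_le_suminf) (use I(2) in auto)
  finally show "ennreal (A / (C * ?\<nu>)) \<le> (\<Sum>i. ennreal (diam_powr s (U i))) + ennreal e" 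
    by (simp add: add_right_mono)
qed

section \<open>Intersections of translated fractal cubes\<close>

lemma real_vec_nth [simp]: "real_vec v $ i = real_of_int (v $ i)"
  by (simp add: real_vec_def)

lemma real_vec_eq_iff [simp]: "real_vec u = real_vec v \<longleftrightarrow> u = v"
  by (simp add: vec_eq_iff)

lemma finite_vec_range:
  assumes "finite A"
  shows "finite {v :: 'a ^ 'k. \<forall>i. v $ i \<in> A}"
proof (rule finite_surj)
  show "finite (PiE (UNIV :: 'k set) (\<lambda>_. A))" using assms by (intro finite_PiE) auto
  show "{v :: 'a ^ 'k. \<forall>i. v $ i \<in> A} \<subseteq> vec_lambda ` PiE UNIV (\<lambda>_. A)"
  proof
    fix v :: "'a ^ 'k" assume "v \<in> {v. \<forall>i. v $ i \<in> A}"
    then show "v \<in> vec_lambda ` PiE UNIV (\<lambda>_. A)"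
      by (intro image_eqI[of _ _ "vec_nth v"]) auto
  qed
qed

lemma finite_sign_vectors [simp]: "finite sign_vectors"
  unfolding sign_vectors_def by (rule finite_vec_range) simp

lemma card_sign_vectors_pos: "0 < card (sign_vectors :: (int ^ 'k) set)"
proof -
  have "(0 :: int ^ 'k) \<in> sign_vectors" by (simp add: sign_vectors_def)
  then show ?thesis by (auto simp: card_gt_0_iff)
qed

lemma finite_digit_cube: "finite (digit_cube n)"
  unfolding digit_cube_def by (rule finite_vec_range) simp

text \<open>Apply self-similarity at the extremal points: the largest coordinate \<open>a\<close>
  satisfies n a \<le> a + n - 1 and the smallest one \<open>b\<close> satisfies b \<le> n b.\<close>

lemma fractal_cube_coord:
  assumes n: "n \<ge> 2" and D: "D \<subseteq> digit_cube n" and K: "is_fractal_cube n D K" and x: "x \<in> K"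
  shows "0 \<le> x $ i \<and> x $ i \<le> 1"
proof -
  have cK: "compact K" "K \<noteq> {}" and KE: "K = {(1 / real n) *\<^sub>R (x + real_vec d) | x d. x \<in> K \<and> d \<in> D}"
    using K unfolding is_fractal_cube_def by blast+
  have cont: "continuous_on K (\<lambda>x. x $ i)" by (intro continuous_intros)
  have dec: "\<exists>y\<in>K. \<exists>d. 0 \<le> d \<and> d \<le> real n - 1 \<and> real n * z $ i = y $ i + d" if "z \<in> K" for z
  proof -
    obtain y d where yd: "y \<in> K" "d \<in> D" "z = (1 / real n) *\<^sub>R (y + real_vec d)"
      using KE \<open>z \<in> K\<close> by blast
    then have "0 \<le> d $ i" "d $ i \<le> int n - 1" using D by (auto simp: digit_cube_def)
    then have "0 \<le> real_of_int (d $ i)" "real_of_int (d $ i) \<le> real n - 1" by linarith+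
    then show ?thesis
      using yd n by (intro bexI[of _ y] exI[of _ "real_of_int (d $ i)"]) auto
  qed
  obtain a where a: "a \<in> K" "\<And>z. z \<in> K \<Longrightarrow> z $ i \<le> a $ i"
    using continuous_attains_sup[OF cK cont] by blast
  obtain b where b: "b \<in> K" "\<And>z. z \<in> K \<Longrightarrow> b $ i \<le> z $ i"
    using continuous_attains_inf[OF cK cont] by blast
  have "real n * a $ i \<le> a $ i + (real n - 1)" using dec[OF a(1)] a(2) by force
  then have "(real n - 1) * (a $ i - 1) \<le> 0" by (simp add: algebra_simps)
  then have "a $ i \<le> 1" using n by (auto simp: mult_le_0_iff)
  moreover have "b $ i \<le> real n * b $ i" using dec[OF b(1)] b(2) by force
  then have "0 \<le> (real n - 1) * b $ i" by (simp add: algebra_simps)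
  then have "0 \<le> b $ i" using n by (auto simp: zero_le_mult_iff)
  ultimately show ?thesis using a(2)[OF x] b(2)[OF x] by linarith
qed

section \<open>The graph-directed system of intersections\<close>

locale fractal_cube_pair =
  fixes n :: nat and D1 D2 :: "(int ^ 'k) set" and K1 K2 :: "(real ^ 'k) set"
  assumes n: "n \<ge> 2" and D1: "D1 \<subseteq> digit_cube n" and D2: "D2 \<subseteq> digit_cube n"
    and K1: "is_fractal_cube n D1 K1" and K2: "is_fractal_cube n D2 K2"
begin

abbreviation "F \<equiv> F_set K1 K2"
text \<open>This is the two-index family; the sets \<open>G_set\<close> are its diagonal, by
  \<open>G_pair_same\<close>.\<close>

abbreviation "G \<equiv> G_pair n D1 D2"
abbreviation "edge \<equiv> structure_edge n D1 D2 K1 K2"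
abbreviation "reach \<equiv> structure_le n D1 D2 K1 K2"

lemma n_pos: "0 < real n" using n by simp

lemma compact_F: "compact (F \<alpha>)"
proof -
  have "{x + real_vec \<alpha> | x. x \<in> K2} = (\<lambda>x. real_vec \<alpha> + x) ` K2" by (auto simp: add.commute)
  then have "compact {x + real_vec \<alpha> | x. x \<in> K2}"
    using K2 by (simp add: is_fractal_cube_def compact_translation)
  then show ?thesis using K1 by (auto simp: F_set_def is_fractal_cube_def intro: compact_Int)
qed

text \<open>Where \<alpha> has entry 1 or -1, the four bounds together pin the coordinate to 1 or
  0.\<close>

lemma F_coord:
  assumes "x \<in> F \<alpha>"
  shows "0 \<le> x $ i" "x $ i \<le> 1" "real_of_int (\<alpha> $ i) \<le> x $ i" "x $ i \<le> real_of_int (\<alpha> $ i) + 1"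
proof -
  obtain z where z: "x \<in> K1" "z \<in> K2" "x = z + real_vec \<alpha>" using assms by (auto simp: F_set_def)
  show "0 \<le> x $ i" "x $ i \<le> 1" using fractal_cube_coord[OF n D1 K1 z(1), of i] by auto
  show "real_of_int (\<alpha> $ i) \<le> x $ i" "x $ i \<le> real_of_int (\<alpha> $ i) + 1"
    using fractal_cube_coord[OF n D2 K2 z(2), of i] z(3) by auto
qed

lemma finite_G: "finite (G \<alpha> \<beta>)"
  unfolding G_pair_def using finite_subset[OF D1 finite_digit_cube] by simp

lemma G_coord:
  assumes "g \<in> G \<alpha> \<beta>"
  obtains d where "g = d + int n *s \<alpha> - \<beta>" "d \<in> D2" "g \<in> D1" "\<And>i. 0 \<le> g $ i" "\<And>i. g $ i < int n"
    "\<And>i. 0 \<le> d $ i" "\<And>i. d $ i < int n" "\<And>i. g $ i = d $ i + int n * \<alpha> $ i - \<beta> $ i"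
proof -
  obtain d where d: "g \<in> D1" "d \<in> D2" "g = d + int n *s \<alpha> - \<beta>" using assms by (auto simp: G_pair_def)
  moreover have "\<And>i. 0 \<le> g $ i \<and> g $ i < int n"
    using subsetD[OF D1 d(1)] by (auto simp: digit_cube_def)
  moreover have "\<And>i. 0 \<le> d $ i \<and> d $ i < int n"
    using subsetD[OF D2 d(2)] by (auto simp: digit_cube_def)
  ultimately show thesis by (intro that[of d]) auto
qed

text \<open>The digit \<open>g\<close> acts on the first cube and its partner \<open>d\<close> on
  the second. The relation between them makes the two images differ by exactly \<alpha>.\<close>

lemma F_shrink:
  assumes "g \<in> G \<alpha> \<beta>" "x \<in> F \<beta>"
  shows "(1 / real n) *\<^sub>R (x + real_vec g) \<in> F \<alpha>"
proof -
  obtain d where d: "g = d + int n *s \<alpha> - \<beta>" "d \<in> D2" "g \<in> D1" by (rule G_coord[OF assms(1)])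
  obtain z where z: "x \<in> K1" "z \<in> K2" "x = z + real_vec \<beta>" using assms(2) by (auto simp: F_set_def)
  have "(1 / real n) *\<^sub>R (x + real_vec g) \<in> K1" using K1 z d unfolding is_fractal_cube_def by blast
  moreover have "(1 / real n) *\<^sub>R (z + real_vec d) \<in> K2" using K2 z d unfolding is_fractal_cube_def by blast
  moreover have "(1 / real n) *\<^sub>R (x + real_vec g) = (1 / real n) *\<^sub>R (z + real_vec d) + real_vec \<alpha>"
    using n by (simp add: vec_eq_iff z(3) d(1) field_simps)
  ultimately show ?thesis unfolding F_set_def by blast
qed

text \<open>Converse of \<open>F_shrink\<close>: a point has one expansion step in each cube, and
  comparing the two determines the next vertex.\<close>

lemma F_decompose:
  assumes "x \<in> F \<alpha>" "\<alpha> \<in> sign_vectors"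
  obtains \<beta> g y where "edge \<alpha> \<beta>" "g \<in> G \<alpha> \<beta>" "y \<in> F \<beta>" "x = (1 / real n) *\<^sub>R (y + real_vec g)"
proof -
  obtain z where z: "x \<in> K1" "z \<in> K2" "x = z + real_vec \<alpha>" using assms(1) by (auto simp: F_set_def)
  obtain y g where y: "y \<in> K1" "g \<in> D1" "x = (1 / real n) *\<^sub>R (y + real_vec g)"
    using z(1) K1 unfolding is_fractal_cube_def by blast
  obtain w d where w: "w \<in> K2" "d \<in> D2" "z = (1 / real n) *\<^sub>R (w + real_vec d)"
    using z(2) K2 unfolding is_fractal_cube_def by blast
  \<comment> \<open>The only choice that makes \<beta> the difference of the remainders
    \<open>y\<close> and \<open>w\<close>.\<close>
  define \<beta> where "\<beta> = d + int n *s \<alpha> - g"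
  have yw: "y = w + real_vec \<beta>"
    using z(3) n unfolding y(3) w(3) \<beta>_def by (simp add: vec_eq_iff field_simps)
  have gG: "g \<in> G \<alpha> \<beta>"
    unfolding G_pair_def \<beta>_def using y(2) w(2) by (auto simp: algebra_simps intro!: exI[of _ d])
  have yF: "y \<in> F \<beta>" using yw y w by (auto simp: F_set_def)
  have beta: "\<beta> $ i \<in> {-1, 0, 1}" for i
  proof -
    have "-1 \<le> real_of_int (\<beta> $ i)" "real_of_int (\<beta> $ i) \<le> 1" using F_coord[OF yF, of i] by auto
    then have "-1 \<le> \<beta> $ i" "\<beta> $ i \<le> 1" by linarith+
    then show ?thesis by auto
  qed
  \<comment> \<open>Digits differ by at most n - 1, so an entry 1 of \<alpha> forces the entry n +
    d' - g of \<beta> to be at least 1; the entry -1 is symmetric.\<close>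
  have "sign_le \<alpha> \<beta>" unfolding sign_le_def
  proof (intro allI impI)
    fix i assume "\<alpha> $ i \<noteq> 0"
    then have a: "\<alpha> $ i = 1 \<or> \<alpha> $ i = -1" using assms(2) by (auto simp: sign_vectors_def)
    obtain d' where d': "0 \<le> g $ i" "g $ i < int n" "0 \<le> d' $ i" "d' $ i < int n"
      "g $ i = d' $ i + int n * \<alpha> $ i - \<beta> $ i"
      by (rule G_coord[OF gG]) blast
    from a show "\<beta> $ i = \<alpha> $ i" using d' beta[of i] by auto
  qed
  then have "edge \<alpha> \<beta>"
    unfolding structure_edge_def using assms beta gG yF by (auto simp: sign_vectors_def)
  then show thesis using that gG yF y(3) by blast
qed

text \<open>The first letter of a path leaving \<open>\<alpha>\<close> places its points in a hyperplane that meets the open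
  cube, at distance \<open>z / n\<close> from a face. This is what keeps different exit times apart.\<close>

lemma strict_edge_coord:
  assumes "edge \<alpha> \<beta>" "\<alpha> \<noteq> \<beta>"
  obtains i where "\<And>g y. g \<in> G \<alpha> \<beta> \<Longrightarrow> y \<in> F \<beta> \<Longrightarrow> \<exists>z::int. y $ i + g $ i = z \<and> 0 < z \<and> z < n"
proof -
  have le: "sign_le \<alpha> \<beta>" and b: "\<beta> \<in> sign_vectors" using assms(1) by (auto simp: structure_edge_def)
  obtain i where i: "\<alpha> $ i \<noteq> \<beta> $ i" using assms(2) by (auto simp: vec_eq_iff)
  then have a0: "\<alpha> $ i = 0" using le by (auto simp: sign_le_def)
  then have b1: "\<beta> $ i = 1 \<or> \<beta> $ i = -1" using i b by (auto simp: sign_vectors_def)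
  show thesis
  proof (rule that[of i])
    fix g y assume g: "g \<in> G \<alpha> \<beta>" and y: "y \<in> F \<beta>"
    obtain d where d: "0 \<le> g $ i" "g $ i < int n" "0 \<le> d $ i" "d $ i < int n"
      "g $ i = d $ i + int n * \<alpha> $ i - \<beta> $ i"
      by (rule G_coord[OF g]) blast
    \<comment> \<open>If \<beta> has entry 1 at \<open>i\<close>, then y = 1 and g = d - 1 there, so
      z = g + 1 = d. If it has entry -1, then y = 0 and z = g = d + 1. Both digits being in range
      excludes 0 and n.\<close>
    from b1 show "\<exists>z::int. y $ i + g $ i = z \<and> 0 < z \<and> z < n"
    proof
      assume "\<beta> $ i = 1"
      then have "y $ i = 1" using F_coord[OF y, of i] by auto
      then show ?thesis using d a0 \<open>\<beta> $ i = 1\<close> by (intro exI[of _ "g $ i + 1"]) auto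
    next
      assume "\<beta> $ i = -1"
      then have "y $ i = 0" using F_coord[OF y, of i] by auto
      then show ?thesis using d a0 \<open>\<beta> $ i = -1\<close> by (intro exI[of _ "g $ i"]) auto
    qed
  qed
qed

section \<open>Reachability and acyclicity\<close>

lemma reach_trans: "reach \<alpha> \<beta> \<Longrightarrow> reach \<beta> \<gamma> \<Longrightarrow> reach \<alpha> \<gamma>"
  unfolding structure_le_def structure_less_def by (auto dest: tranclp_trans)

lemma edge_reach: "edge \<alpha> \<beta> \<Longrightarrow> reach \<alpha> \<beta>"
  unfolding structure_le_def structure_less_def by auto

lemma reach_vertex:
  assumes "reach \<alpha> \<beta>" "\<alpha> \<in> sign_vectors" "F \<alpha> \<noteq> {}"
  shows "\<beta> \<in> sign_vectors" "F \<beta> \<noteq> {}"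
proof -
  have "\<beta> \<in> sign_vectors \<and> F \<beta> \<noteq> {}"
    using assms unfolding structure_le_def structure_less_def
    by (metis (no_types, lifting) structure_edge_def tranclp.cases)
  then show "\<beta> \<in> sign_vectors" "F \<beta> \<noteq> {}" by auto
qed

text \<open>A rank that drops along every non-loop edge; it carries all inductions over the
  graph.\<close>

definition zeros :: "int ^ 'k \<Rightarrow> nat" where "zeros \<alpha> = card {i. \<alpha> $ i = 0}"

lemma zeros_less:
  assumes "edge \<alpha> \<beta>" "\<alpha> \<noteq> \<beta>"
  shows "zeros \<beta> < zeros \<alpha>"
proof -
  have le: "sign_le \<alpha> \<beta>" using assms(1) by (simp add: structure_edge_def)
  obtain i where i: "\<alpha> $ i \<noteq> \<beta> $ i" using assms(2) by (auto simp: vec_eq_iff)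
  have "i \<in> {i. \<alpha> $ i = 0}" "i \<notin> {i. \<beta> $ i = 0}" using i le by (auto simp: sign_le_def)
  moreover have "{i. \<beta> $ i = 0} \<subseteq> {i. \<alpha> $ i = 0}" using le by (force simp: sign_le_def)
  ultimately have "{i. \<beta> $ i = 0} \<subset> {i. \<alpha> $ i = 0}" by blast
  then show ?thesis unfolding zeros_def by (intro psubset_card_mono) auto
qed

lemma reach_zeros_le:
  assumes "reach \<alpha> \<beta>"
  shows "zeros \<beta> \<le> zeros \<alpha>"
proof -
  have "zeros \<beta> < zeros \<alpha>" if "(\<lambda>\<alpha> \<beta>. edge \<alpha> \<beta> \<and> \<alpha> \<noteq> \<beta>)\<^sup>+\<^sup>+ \<alpha> \<beta>"
    using that by (induction rule: tranclp_induct) (auto dest!: zeros_less)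
  then show ?thesis using assms by (auto simp: structure_le_def structure_less_def intro: less_imp_le)
qed

text \<open>A point of \<open>F \<alpha>\<close> supplies an edge, which is a loop or lowers the
  rank. This yields \<nu> \<ge> 1, so that the logarithm is meaningful.\<close>

lemma ex_loop:
  assumes "\<alpha> \<in> sign_vectors" "F \<alpha> \<noteq> {}"
  shows "\<exists>\<beta>. reach \<alpha> \<beta> \<and> G \<beta> \<beta> \<noteq> {}"
  using assms
proof (induction "zeros \<alpha>" arbitrary: \<alpha> rule: less_induct)
  case less
  obtain x where "x \<in> F \<alpha>" using less.prems by blast
  then obtain \<beta> g where b: "edge \<alpha> \<beta>" "g \<in> G \<alpha> \<beta>" using F_decompose less.prems by metis
  show ?case
  proof (cases "\<beta> = \<alpha>")
    case True
    then show ?thesis using b by (auto simp: structure_le_def)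
  next
    case False
    then have "\<exists>\<gamma>. reach \<beta> \<gamma> \<and> G \<gamma> \<gamma> \<noteq> {}"
      using zeros_less[OF b(1)] b(1) by (intro less.hyps) (auto simp: structure_edge_def)
    then show ?thesis using reach_trans[OF edge_reach[OF b(1)]] by blast
  qed
qed

subsection \<open>Lower bounds\<close>

text \<open>A word of digits is encoded by the integer vector \<open>v\<close> that it represents in base \<open>n\<close>, so
  \<open>v div n ^ j\<close> forgets its last \<open>j\<close> letters.\<close>

definition thin :: "nat \<Rightarrow> (int ^ 'k) set \<Rightarrow> bool" where
  "thin \<nu> V \<longleftrightarrow> finite V \<and> (\<forall>j u. card {v \<in> V. \<forall>i. v $ i div int n ^ j = u $ i} \<le> \<nu> ^ j)"

definition append_digits :: "(int ^ 'k) set \<Rightarrow> (int ^ 'k) set \<Rightarrow> (int ^ 'k) set" where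
  "append_digits V \<Gamma> = (\<lambda>(v, g). int n *s v + g) ` (V \<times> \<Gamma>)"

lemma append_digits_div:
  assumes "g \<in> digit_cube n"
  shows "(int n * v $ i + g $ i) div int n = v $ i"
  using assms n by (auto simp: digit_cube_def)

text \<open>Division by \<open>n\<close> recovers the old word, and then the difference recovers the
  new digit.\<close>

lemma card_append_digits:
  assumes "\<Gamma> \<subseteq> digit_cube n"
  shows "card (append_digits V \<Gamma>) = card V * card \<Gamma>"
proof -
  have "inj_on (\<lambda>(v, g). int n *s v + g) (V \<times> \<Gamma>)"
  proof (rule inj_onI, clarsimp)
    fix v g v' g' assume a: "g \<in> \<Gamma>" "g' \<in> \<Gamma>" "int n *s v + g = int n *s v' + g'"
    have "v $ i = v' $ i" for i
    proof -
      have "int n * v $ i + g $ i = int n * v' $ i + g' $ i"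
        using a(3) by (simp add: vec_eq_iff)
      then show ?thesis
        using append_digits_div[of g v i] append_digits_div[of g' v' i] subsetD[OF assms a(1)]
          subsetD[OF assms a(2)] by simp
    qed
    then have "v = v'" by (simp add: vec_eq_iff)
    then show "v = v' \<and> g = g'" using a(3) by simp
  qed
  then show ?thesis unfolding append_digits_def by (simp add: card_image card_cartesian_product)
qed

text \<open>Forgetting \<open>Suc m\<close> letters first drops the new one, for which there are at
  most \<nu> choices, and then \<open>m\<close> old ones.\<close>

lemma thin_append_digits:
  assumes V: "thin \<nu> V" and \<Gamma>: "\<Gamma> \<subseteq> digit_cube n" "card \<Gamma> \<le> \<nu>"
  shows "thin \<nu> (append_digits V \<Gamma>)"
  unfolding thin_def
proof (intro conjI allI)
  have "finite \<Gamma>" using \<Gamma> finite_digit_cube finite_subset by blast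
  then show fin: "finite (append_digits V \<Gamma>)"
    using V unfolding append_digits_def thin_def by auto
  fix j and u :: "int ^ 'k"
  show "card {v \<in> append_digits V \<Gamma>. \<forall>i. v $ i div int n ^ j = u $ i} \<le> \<nu> ^ j"
  proof (cases j)
    case 0
    have "{v \<in> append_digits V \<Gamma>. \<forall>i. v $ i div int n ^ j = u $ i} \<subseteq> {u}"
      using 0 by (auto simp: vec_eq_iff)
    from card_mono[OF _ this] show ?thesis using 0 by simp
  next
    case (Suc m)
    let ?W = "{v \<in> V. \<forall>i. v $ i div int n ^ m = u $ i}"
    have "{v \<in> append_digits V \<Gamma>. \<forall>i. v $ i div int n ^ j = u $ i} \<subseteq> append_digits ?W \<Gamma>"
    proof
      fix w assume "w \<in> {v \<in> append_digits V \<Gamma>. \<forall>i. v $ i div int n ^ j = u $ i}"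
      then obtain v g where vg: "v \<in> V" "g \<in> \<Gamma>" "w = int n *s v + g"
        and w: "\<And>i. w $ i div int n ^ j = u $ i" by (auto simp: append_digits_def)
      have "v $ i div int n ^ m = u $ i" for i
      proof -
        have "w $ i div int n ^ j = (w $ i div int n) div int n ^ m"
          using Suc by (simp add: zdiv_zmult2_eq)
        also have "w $ i div int n = v $ i"
          using append_digits_div[of g v i] vg \<Gamma> by auto
        finally show ?thesis using w by simp
      qed
      then show "w \<in> append_digits ?W \<Gamma>" using vg by (auto simp: append_digits_def)
    qed
    then have "card {v \<in> append_digits V \<Gamma>. \<forall>i. v $ i div int n ^ j = u $ i} \<le> card (append_digits ?W \<Gamma>)"
      using V \<open>finite \<Gamma>\<close> by (intro card_mono) (auto simp: append_digits_def thin_def)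
    also have "\<dots> = card ?W * card \<Gamma>" by (rule card_append_digits[OF \<Gamma>(1)])
    also have "\<dots> \<le> \<nu> ^ m * \<nu>" using V \<Gamma>(2) by (intro mult_mono) (auto simp: thin_def)
    finally show ?thesis using Suc by (simp add: mult.commute)
  qed
qed

lemma thin_singleton: "1 \<le> \<nu> \<Longrightarrow> thin \<nu> {v}"
  unfolding thin_def
proof (intro conjI allI)
  fix j and u :: "int ^ 'k"
  assume "1 \<le> \<nu>"
  have "card {w \<in> {v}. \<forall>i. w $ i div int n ^ j = u $ i} \<le> card {v}" by (rule card_mono) auto
  also have "\<dots> \<le> \<nu> ^ j" using \<open>1 \<le> \<nu>\<close> by simp
  finally show "card {w \<in> {v}. \<forall>i. w $ i div int n ^ j = u $ i} \<le> \<nu> ^ j" .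
qed simp

section \<open>Families of words ending at a vertex\<close>

text \<open>\<open>V\<close> collects prefixes of length \<open>M\<close> of paths ending at
  \<beta>. The paths are not recorded; whatever must be remembered about them is put into the target
  set \<open>E\<close>.\<close>

definition words :: "nat \<Rightarrow> (real ^ 'k) set \<Rightarrow> nat \<Rightarrow> nat \<Rightarrow> int ^ 'k \<Rightarrow> bool" where
  "words \<nu> E c M \<beta> \<longleftrightarrow> (\<exists>V. thin \<nu> V \<and> card V = c \<and>
     (\<forall>x\<in>F \<beta>. \<forall>v\<in>V. (1 / real n) ^ M *\<^sub>R (x + real_vec v) \<in> E))"

lemma words_start: "1 \<le> \<nu> \<Longrightarrow> words \<nu> (F \<alpha>) 1 0 \<alpha>"
  unfolding words_def
  by (intro exI[of _ "{0}"]) (auto simp: thin_singleton real_vec_def vec_eq_iff zero_vec_def[symmetric])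

lemma append_point:
  "(1 / real n) ^ Suc M *\<^sub>R (x + real_vec (int n *s v + g)) =
     (1 / real n) ^ M *\<^sub>R ((1 / real n) *\<^sub>R (x + real_vec g) + real_vec v)"
  using n by (simp add: vec_eq_iff field_simps)

text \<open>The last assumption lets the new letter shrink the target from \<open>E\<close> to
  \<open>E'\<close>. Loops keep E' = E; leaving a vertex will record the exit time.\<close>

lemma words_append:
  assumes "words \<nu> E c M \<beta>" "\<Gamma> \<subseteq> G \<beta> \<gamma>" "card \<Gamma> \<le> \<nu>"
    and E: "\<And>x g v. x \<in> F \<gamma> \<Longrightarrow> g \<in> G \<beta> \<gamma> \<Longrightarrow>
      (1 / real n) ^ M *\<^sub>R ((1 / real n) *\<^sub>R (x + real_vec g) + real_vec v) \<in> E \<Longrightarrow>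
      (1 / real n) ^ M *\<^sub>R ((1 / real n) *\<^sub>R (x + real_vec g) + real_vec v) \<in> E'"
  shows "words \<nu> E' (c * card \<Gamma>) (Suc M) \<gamma>"
proof -
  obtain V where V: "thin \<nu> V" "card V = c"
    "\<And>x v. x \<in> F \<beta> \<Longrightarrow> v \<in> V \<Longrightarrow> (1 / real n) ^ M *\<^sub>R (x + real_vec v) \<in> E"
    using assms(1) by (auto simp: words_def)
  have \<Gamma>: "\<Gamma> \<subseteq> digit_cube n" using assms(2) D1 by (auto simp: G_pair_def)
  have "(1 / real n) ^ Suc M *\<^sub>R (x + real_vec w) \<in> E'"
    if x: "x \<in> F \<gamma>" and w: "w \<in> append_digits V \<Gamma>" for x w
  proof -
    obtain v g where vg: "v \<in> V" "g \<in> \<Gamma>" "w = int n *s v + g"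
      using w by (auto simp: append_digits_def)
    then show ?thesis
      unfolding vg(3) append_point using assms(2) x
      by (intro E V(3) F_shrink) auto
  qed
  then show ?thesis
    unfolding words_def
    using thin_append_digits[OF V(1) \<Gamma> assms(3)] card_append_digits[OF \<Gamma>, of V] V(2) by blast
qed

text \<open>A single letter is used on the edge: the count stays the same and only length is
  spent.\<close>

lemma words_edge:
  assumes "words \<nu> E c M \<beta>" "edge \<beta> \<gamma>" "1 \<le> \<nu>"
    and E: "\<And>x g v. x \<in> F \<gamma> \<Longrightarrow> g \<in> G \<beta> \<gamma> \<Longrightarrow>
      (1 / real n) ^ M *\<^sub>R ((1 / real n) *\<^sub>R (x + real_vec g) + real_vec v) \<in> E \<Longrightarrow>
      (1 / real n) ^ M *\<^sub>R ((1 / real n) *\<^sub>R (x + real_vec g) + real_vec v) \<in> E'"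
  shows "words \<nu> E' c (Suc M) \<gamma>"
proof -
  obtain g where "g \<in> G \<beta> \<gamma>" using assms(2) by (auto simp: structure_edge_def)
  then show ?thesis using words_append[OF assms(1), of "{g}" \<gamma> E'] assms(3) E by simp
qed

lemma words_loops:
  assumes "words \<nu> E c M \<beta>" "card (G \<beta> \<beta>) = \<nu>"
  shows "words \<nu> E (c * \<nu> ^ j) (M + j) \<beta>"
proof (induction j)
  case (Suc j)
  from words_append[OF Suc, of "G \<beta> \<beta>" \<beta> E] assms(2) show ?case by (simp add: mult_ac)
qed (use assms in simp)

text \<open>The length \<open>p\<close> is chosen before \<open>E\<close>, \<open>c\<close> and
  \<open>M\<close>, hence is the same for all exit times later on.\<close>

lemma words_path:
  assumes "reach \<beta> \<gamma>" "1 \<le> \<nu>"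
  shows "\<exists>p. \<forall>E c M. words \<nu> E c M \<beta> \<longrightarrow> words \<nu> E c (M + p) \<gamma>"
proof (cases "\<gamma> = \<beta>")
  case False
  then have "(\<lambda>\<alpha> \<beta>. edge \<alpha> \<beta> \<and> \<alpha> \<noteq> \<beta>)\<^sup>+\<^sup>+ \<beta> \<gamma>"
    using assms(1) by (simp add: structure_le_def structure_less_def)
  then show ?thesis
  proof (induction rule: tranclp_induct)
    case (base \<gamma>)
    then show ?case using words_edge[OF _ _ assms(2)] by (intro exI[of _ 1]) fastforce
  next
    case (step \<gamma> \<delta>)
    then obtain p where "\<forall>E c M. words \<nu> E c M \<beta> \<longrightarrow> words \<nu> E c (M + p) \<gamma>" by blast
    then show ?case using words_edge[OF _ _ assms(2)] step(2) by (intro exI[of _ "Suc p"]) fastforce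
  qed
qed (auto intro: exI[of _ 0])

text \<open>One point per word. If two of the points are within \<open>(1 / n) ^ m\<close>, the
  words shortened by L - m letters differ by at most 1 in each coordinate, so a set of this size
  meets at most \<open>card sign_vectors\<close> classes, each bounded by thinness.\<close>

lemma words_points:
  assumes W: "words \<nu> E c L \<gamma>" and x0: "F \<gamma> \<noteq> {}"
  shows "\<exists>X\<subseteq>E. finite X \<and> card X = c \<and> (\<forall>U m. bounded U \<longrightarrow> m \<le> L \<longrightarrow> diameter U \<le> (1 / real n) ^ m \<longrightarrow>
    card (X \<inter> U) \<le> card (sign_vectors :: (int ^ 'k) set) * \<nu> ^ (L - m))"
proof -
  obtain V where V: "thin \<nu> V" "card V = c"
    "\<And>x v. x \<in> F \<gamma> \<Longrightarrow> v \<in> V \<Longrightarrow> (1 / real n) ^ L *\<^sub>R (x + real_vec v) \<in> E"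
    using W by (auto simp: words_def)
  obtain x0 where x0: "x0 \<in> F \<gamma>" using x0 by blast
  define f where "f v = (1 / real n) ^ L *\<^sub>R (x0 + real_vec v)" for v :: "int ^ 'k"
  have inj: "inj f" using n by (auto simp: inj_def f_def)
  have finV: "finite V" using V by (simp add: thin_def)
  have "card (f ` V \<inter> U) \<le> card (sign_vectors :: (int ^ 'k) set) * \<nu> ^ (L - m)"
    if U: "bounded U" "m \<le> L" "diameter U \<le> (1 / real n) ^ m" for U m
  proof (cases "f ` V \<inter> U = {}")
    case False
    then obtain v0 where v0: "v0 \<in> V" "f v0 \<in> U" by blast
    define q where "q = int n ^ (L - m)"
    have q: "q > 0" using n by (simp add: q_def)
    \<comment> \<open>The class whose shortened word is that of \<open>v0\<close> shifted by
      \<open>t\<close>.\<close>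
    define B where "B t = {v \<in> V. \<forall>i. v $ i div q = ((\<chi> i. v0 $ i div q) + t) $ i}" for t
    have "f ` V \<inter> U \<subseteq> f ` (\<Union>t\<in>sign_vectors. B t)"
    proof
      fix y assume "y \<in> f ` V \<inter> U"
      then obtain v where v: "v \<in> V" "f v \<in> U" "y = f v" by blast
      have close: "\<bar>v $ i - v0 $ i\<bar> \<le> q" for i
      proof -
        have "\<bar>(f v - f v0) $ i\<bar> \<le> dist (f v) (f v0)"
          unfolding dist_norm by (rule component_le_norm_cart)
        also have "\<dots> \<le> (1 / real n) ^ m"
          using diameter_bounded_bound[OF U(1) v(2) v0(2)] U(3) by linarith
        also have "(f v - f v0) $ i = (1 / real n) ^ L * real_of_int (v $ i - v0 $ i)"
          by (simp add: f_def algebra_simps)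
        finally have "(1 / real n) ^ L * \<bar>real_of_int (v $ i - v0 $ i)\<bar> \<le> (1 / real n) ^ m"
          by (simp add: abs_mult)
        then have "\<bar>real_of_int (v $ i - v0 $ i)\<bar> \<le> real n ^ L * (1 / real n) ^ m"
          using n by (simp add: field_simps power_one_over)
        also have "\<dots> = real n ^ (L - m)"
          using n U(2) by (simp add: power_one_over power_diff)
        also have "\<dots> = real_of_int q" by (simp add: q_def)
        finally show ?thesis by linarith
      qed
      have div: "v $ i div q - v0 $ i div q \<in> {-1, 0, 1}" for i
      proof -
        have "v $ i \<le> v0 $ i + q" "v0 $ i - q \<le> v $ i" using close[of i] by linarith+
        then have "v $ i div q \<le> (v0 $ i + q) div q" "(v0 $ i - q) div q \<le> v $ i div q"
          using q by (simp_all only: zdiv_mono1)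
        moreover have "(v0 $ i + q) div q = v0 $ i div q + 1" using q by simp
        moreover have "(v0 $ i - q) div q = v0 $ i div q - 1"
          using q div_add_self2[of q "v0 $ i - q"] by simp
        ultimately have "v $ i div q - v0 $ i div q \<le> 1" "-1 \<le> v $ i div q - v0 $ i div q"
          by linarith+
        then show ?thesis by auto
      qed
      have "v \<in> B (\<chi> i. v $ i div q - v0 $ i div q)" using v by (simp add: B_def)
      moreover have "(\<chi> i. v $ i div q - v0 $ i div q) \<in> (sign_vectors :: (int ^ 'k) set)"
        using div by (auto simp: sign_vectors_def)
      ultimately show "y \<in> f ` (\<Union>t\<in>sign_vectors. B t)" using v(3) by blast
    qed
    then have "card (f ` V \<inter> U) \<le> card (f ` (\<Union>t\<in>sign_vectors. B t))"
      using finV by (intro card_mono) (auto simp: B_def)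
    also have "\<dots> \<le> card (\<Union>t\<in>sign_vectors. B t)"
      using finV by (intro card_image_le) (auto simp: B_def)
    also have "\<dots> \<le> (\<Sum>t\<in>sign_vectors. card (B t))" by (intro card_UN_le) simp
    also have "\<dots> \<le> (\<Sum>t\<in>(sign_vectors :: (int ^ 'k) set). \<nu> ^ (L - m))"
      using V(1) unfolding B_def q_def thin_def by (intro sum_mono) blast
    finally show ?thesis by simp
  qed simp
  then show ?thesis
    using finV V x0 card_image[OF inj_on_subset[OF inj subset_UNIV], of V]
    by (intro exI[of _ "f ` V"]) (auto simp: f_def)
qed

text \<open>A set of diameter below \<delta> meets at most one of the \<open>J\<close> separated
  pieces. The local density is that of a single piece while the total mass is \<open>J\<close> times
  as large.\<close>

lemma hausdorff_premeasure_ge_words: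
  assumes S: "compact S" and s: "0 \<le> s" "n powr s = real \<nu>" and \<delta>: "0 < \<delta>" "\<delta> \<le> 1"
    and \<gamma>: "F \<gamma> \<noteq> {}" and E: "\<And>j. j < J \<Longrightarrow> E j \<subseteq> S"
    and sep: "\<And>i j x y. i < j \<Longrightarrow> j < J \<Longrightarrow> x \<in> E i \<Longrightarrow> y \<in> E j \<Longrightarrow> \<delta> \<le> dist x y"
    and W: "\<And>j L. j < J \<Longrightarrow> N \<le> L \<Longrightarrow> words \<nu> (E j) (\<nu> ^ (L - q)) L \<gamma>" and q: "q \<le> N"
  shows "ennreal (real J / real \<nu> ^ q / (card (sign_vectors :: (int ^ 'k) set) * real \<nu>))
    \<le> hausdorff_premeasure s (\<delta> / 2) S"
proof -
  let ?C = "card (sign_vectors :: (int ^ 'k) set)"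
  have "0 < ?C" by (rule card_sign_vectors_pos)
  have \<nu>: "real \<nu> > 0" using n s(2) by (metis powr_gt_zero n_pos order_less_irrefl)
  have "\<exists>X\<subseteq>S. finite X \<and> real J / real \<nu> ^ q * (n powr s) ^ L \<le> card X \<and>
      (\<forall>U m. bounded U \<longrightarrow> diameter U < \<delta> \<longrightarrow> m \<le> L \<longrightarrow> diameter U \<le> (1 / real n) ^ m \<longrightarrow>
         card (X \<inter> U) \<le> real ?C * (n powr s) ^ (L - m))" if L: "N \<le> L" for L
  proof -
    have "\<exists>X\<subseteq>E j. finite X \<and> card X = \<nu> ^ (L - q) \<and>
      (\<forall>U m. bounded U \<longrightarrow> m \<le> L \<longrightarrow> diameter U \<le> (1 / real n) ^ m \<longrightarrow> card (X \<inter> U) \<le> ?C * \<nu> ^ (L - m))"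
      if "j < J" for j
      using words_points[OF W[OF that L] \<gamma>] .
    then obtain X where X: "\<And>j. j < J \<Longrightarrow> X j \<subseteq> E j \<and> finite (X j) \<and> card (X j) = \<nu> ^ (L - q) \<and>
      (\<forall>U m. bounded U \<longrightarrow> m \<le> L \<longrightarrow> diameter U \<le> (1 / real n) ^ m \<longrightarrow> card (X j \<inter> U) \<le> ?C * \<nu> ^ (L - m))"
      by metis
    have dist: "\<delta> \<le> dist x y" if "i < J" "j < J" "i \<noteq> j" "x \<in> X i" "y \<in> X j" for i j x y
      using that X[OF that(1)] X[OF that(2)] sep[of i j x y] sep[of j i y x]
      by (metis dist_commute linorder_neqE_nat subset_iff)
    define Y where "Y = (\<Union>j<J. X j)"
    have "card Y = (\<Sum>j<J. card (X j))" unfolding Y_def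
    proof (rule card_UN_disjoint)
      show "\<forall>i\<in>{..<J}. \<forall>j\<in>{..<J}. i \<noteq> j \<longrightarrow> X i \<inter> X j = {}"
      proof (intro ballI impI)
        fix i j assume ij: "i \<in> {..<J}" "j \<in> {..<J}" "i \<noteq> j"
        have "x \<notin> X j" if "x \<in> X i" for x
          using dist[of i j x x] ij that \<delta>(1) by auto
        then show "X i \<inter> X j = {}" by blast
      qed
    qed (use X in auto)
    also have "\<dots> = J * \<nu> ^ (L - q)" using X by simp
    finally have cardY: "card Y = J * \<nu> ^ (L - q)" .
    have "real J / real \<nu> ^ q * real \<nu> ^ L = real J * real \<nu> ^ (L - q)"
      using \<nu> q L by (simp add: power_diff)
    then have "real J / real \<nu> ^ q * (n powr s) ^ L \<le> card Y"
      unfolding s(2) cardY by simp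
    moreover have "card (Y \<inter> U) \<le> real ?C * (n powr s) ^ (L - m)"
      if U: "bounded U" "diameter U < \<delta>" "m \<le> L" "diameter U \<le> (1 / real n) ^ m" for U m
    proof (cases "Y \<inter> U = {}")
      case False
      then obtain x j where xj: "j < J" "x \<in> X j" "x \<in> U" by (auto simp: Y_def)
      have "Y \<inter> U \<subseteq> X j \<inter> U"
      proof
        fix y assume y: "y \<in> Y \<inter> U"
        then obtain i where i: "i < J" "y \<in> X i" by (auto simp: Y_def)
        have "dist y x < \<delta>" using diameter_bounded_bound[OF U(1), of y x] y xj U(2) by auto
        then have "i = j" using dist[OF i(1) xj(1) _ i(2) xj(2)] by linarith
        then show "y \<in> X j \<inter> U" using y i by simp
      qed
      then have "card (Y \<inter> U) \<le> card (X j \<inter> U)" using X[OF xj(1)] by (intro card_mono) auto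
      also have "\<dots> \<le> ?C * \<nu> ^ (L - m)" using X[OF xj(1)] U by blast
      finally have "real (card (Y \<inter> U)) \<le> real (?C * \<nu> ^ (L - m))" by (rule of_nat_mono)
      then show ?thesis by (simp add: s(2))
    qed simp
    moreover have "finite Y" unfolding Y_def by (intro finite_UN_I) (use X in auto)
    moreover have "Y \<subseteq> S" unfolding Y_def using X E by blast
    ultimately show ?thesis by blast
  qed
  from hausdorff_premeasure_ge[OF S \<delta> _ s(1) _ this] show ?thesis
    using n \<open>0 < ?C\<close> s(2) by simp
qed

text \<open>Walk to \<beta> along a fixed path and then only loop there; this is the case of one
  piece, with \<delta> = 1 and nothing to separate.\<close>

lemma hausdorff_measure_pos:
  assumes "0 \<le> s" "n powr s = real \<nu>" "\<alpha> \<in> sign_vectors" "F \<alpha> \<noteq> {}" "reach \<alpha> \<beta>" "card (G \<beta> \<beta>) = \<nu>"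
  shows "hausdorff_measure s (F \<alpha>) > 0"
proof -
  have \<nu>: "real \<nu> > 0" using n assms(2) by (metis powr_gt_zero n_pos order_less_irrefl)
  then have \<nu>1: "1 \<le> \<nu>" by simp
  obtain p where p: "words \<nu> (F \<alpha>) 1 (0 + p) \<beta>"
    using words_path[OF assms(5) \<nu>1] words_start[OF \<nu>1] by blast
  have "words \<nu> (F \<alpha>) (\<nu> ^ (L - p)) L \<beta>" if "p \<le> L" for L
    using words_loops[OF p assms(6), of "L - p"] that by simp
  then have "ennreal (real 1 / real \<nu> ^ p / (card (sign_vectors :: (int ^ 'k) set) * real \<nu>))
      \<le> hausdorff_premeasure s (1 / 2) (F \<alpha>)"
    by (intro hausdorff_premeasure_ge_words[where E = "\<lambda>_. F \<alpha>" and N = p and \<gamma> = \<beta>] compact_F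
        reach_vertex(2)[OF assms(5)] assms(1-4)) auto
  moreover have "0 < real \<nu> ^ p * (real (card (sign_vectors :: (int ^ 'k) set)) * real \<nu>)"
    using \<nu> by (intro mult_pos_pos zero_less_power) (simp_all add: card_sign_vectors_pos)
  then have "0 < ennreal (real 1 / real \<nu> ^ p / (card (sign_vectors :: (int ^ 'k) set) * real \<nu>))"
    by simp
  ultimately have "0 < hausdorff_premeasure s (1 / 2) (F \<alpha>)" by order
  also have "\<dots> \<le> hausdorff_measure s (F \<alpha>)" by (rule hausdorff_measure_ge_premeasure) simp
  finally show ?thesis .
qed

text \<open>For a point whose path leaves \<open>\<beta>\<close> after \<open>j\<close> loops, the coordinate from
  \<open>strict_edge_coord\<close> is an integer multiple of \<open>1 / n ^ (q + j + 1)\<close> but not of \<open>1 / n ^ (q + j)\<close>.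
  So the pieces \<open>E j\<close> are separated, while each of them carries the same mass.\<close>

lemma hausdorff_measure_infinite:
  assumes s: "0 \<le> s" "n powr s = real \<nu>" and \<alpha>: "\<alpha> \<in> sign_vectors" "F \<alpha> \<noteq> {}"
    and \<beta>: "reach \<alpha> \<beta>" "card (G \<beta> \<beta>) = \<nu>"
    and \<gamma>: "structure_less n D1 D2 K1 K2 \<beta> \<gamma>" "card (G \<gamma> \<gamma>) = \<nu>"
  shows "hausdorff_measure s (F \<alpha>) = \<infinity>"
proof -
  have \<nu>: "real \<nu> > 0" using n s(2) by (metis powr_gt_zero n_pos order_less_irrefl)
  then have \<nu>1: "1 \<le> \<nu>" by simp
  obtain \<beta>' where \<beta>': "edge \<beta> \<beta>'" "\<beta> \<noteq> \<beta>'" "reach \<beta>' \<gamma>"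
    using \<gamma>(1) unfolding structure_less_def structure_le_def
    by (blast elim: converse_tranclpE)
  obtain i where i: "\<And>g y. g \<in> G \<beta> \<beta>' \<Longrightarrow> y \<in> F \<beta>' \<Longrightarrow> \<exists>z::int. y $ i + g $ i = z \<and> 0 < z \<and> z < n"
    using strict_edge_coord[OF \<beta>'(1,2)] by blast
  obtain q where q: "words \<nu> (F \<alpha>) 1 (0 + q) \<beta>"
    using words_path[OF \<beta>(1) \<nu>1] words_start[OF \<nu>1] by blast
  obtain p where p: "\<And>E c M. words \<nu> E c M \<beta>' \<Longrightarrow> words \<nu> E c (M + p) \<gamma>"
    using words_path[OF \<beta>'(3) \<nu>1] by blast
  define E where "E j = {x \<in> F \<alpha>. real n ^ (q + j + 1) * x $ i \<in> \<int> \<and> real n ^ (q + j) * x $ i \<notin> \<int>}" for j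
  \<comment> \<open>The exponent is free of \<open>j\<close>: only the q letters leading to \<beta>,
    the exit letter and the p letters leading to \<gamma> fail to multiply the count by
    \<nu>.\<close>
  have WE: "words \<nu> (E j) (\<nu> ^ (L - (q + 1 + p))) L \<gamma>" if "q + 1 + p + j \<le> L" for j L
  proof -
    have "words \<nu> (F \<alpha>) (\<nu> ^ j) (q + j) \<beta>" using words_loops[OF q \<beta>(2), of j] by simp
    then have "words \<nu> (E j) (\<nu> ^ j) (Suc (q + j)) \<beta>'"
    proof (rule words_edge[OF _ \<beta>'(1) \<nu>1])
      fix x :: "real ^ 'k" and g v :: "int ^ 'k"
      let ?y = "(1 / real n) ^ (q + j) *\<^sub>R ((1 / real n) *\<^sub>R (x + real_vec g) + real_vec v)"
      assume x: "x \<in> F \<beta>'" "g \<in> G \<beta> \<beta>'" "?y \<in> F \<alpha>"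
      obtain z :: int where z: "x $ i + g $ i = z" "0 < z" "z < n" using i[OF x(2,1)] by auto
      have e0: "real n ^ (q + j) * ?y $ i = z / n + v $ i"
        using n by (simp add: power_one_over flip: z(1))
      have "real n ^ (q + j + 1) * ?y $ i = real n * (real n ^ (q + j) * ?y $ i)" by simp
      also have "\<dots> = z + n * v $ i" unfolding e0 using n by (simp add: field_simps)
      finally have e1: "real n ^ (q + j + 1) * ?y $ i = z + n * v $ i" .
      have "real n ^ (q + j + 1) * ?y $ i \<in> \<int>" unfolding e1 by simp
      moreover have "real n ^ (q + j) * ?y $ i \<notin> \<int>"
      proof
        assume "real n ^ (q + j) * ?y $ i \<in> \<int>"
        then obtain w :: int where "z / n + v $ i = real_of_int w" unfolding e0 by (rule Ints_cases)
        then have "z / n = real_of_int (w - v $ i)" by simp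
        moreover have "0 < z / n" "z / n < 1" using z n by auto
        ultimately have "0 < w - v $ i" "w - v $ i < 1" by (simp_all only: of_int_0_less_iff of_int_less_1_iff)
        then show False by linarith
      qed
      ultimately show "?y \<in> E j" using x(3) by (simp add: E_def)
    qed
    then have "words \<nu> (E j) (\<nu> ^ j) (Suc (q + j) + p) \<gamma>" by (rule p)
    from words_loops[OF this \<gamma>(2), of "L - (Suc (q + j) + p)"]
    show ?thesis using that by (simp flip: power_add)
  qed
  have big: "ennreal (real J / real \<nu> ^ (q + 1 + p) / (card (sign_vectors :: (int ^ 'k) set) * real \<nu>))
      \<le> hausdorff_measure s (F \<alpha>)" for J
  proof -
    \<comment> \<open>For all j < J the coordinate \<open>i\<close> of points of \<open>E j\<close>
      lies in the grid of mesh \<delta>, so different values are at least \<delta> apart.\<close>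
    define \<delta> where "\<delta> = (1 / real n) ^ (q + J)"
    have \<delta>: "0 < \<delta>" "\<delta> \<le> 1" using n by (auto simp: \<delta>_def power_le_one)
    have sep: "\<delta> \<le> dist x y" if jj: "j < j'" "j' < J" and x: "x \<in> E j" and y: "y \<in> E j'" for j j' x y
    proof -
      have int: "real n ^ a * t \<in> \<int>" if "real n ^ b * t \<in> \<int>" "b \<le> a" for a b t
      proof -
        have "real n ^ a * t = of_int (int n ^ (a - b)) * (real n ^ b * t)"
          using that(2) by (simp flip: power_add mult.assoc)
        then show ?thesis using that(1) by (metis Ints_mult Ints_of_int)
      qed
      \<comment> \<open>Since j < j', the scale q + j' already makes the coordinate of
        \<open>x\<close> integral, but not that of \<open>y\<close>.\<close>
      have xi: "real n ^ (q + j') * x $ i \<in> \<int>" "real n ^ (q + J) * x $ i \<in> \<int>"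
        using x jj by (auto simp: E_def intro: int[of "q + j + 1"] simp del: power_Suc)
      have yi: "real n ^ (q + J) * y $ i \<in> \<int>" "real n ^ (q + j') * y $ i \<notin> \<int>"
        using y jj by (auto simp: E_def intro: int[of "q + j' + 1"] simp del: power_Suc)
      have "x $ i \<noteq> y $ i" using xi yi by auto
      then have "real n ^ (q + J) * (x $ i - y $ i) \<noteq> 0" using n by simp
      moreover have "real n ^ (q + J) * (x $ i - y $ i) \<in> \<int>" using xi yi by (simp add: right_diff_distrib)
      ultimately have "1 \<le> \<bar>real n ^ (q + J) * (x $ i - y $ i)\<bar>" by (rule Ints_nonzero_abs_ge1[rotated])
      then have "1 \<le> real n ^ (q + J) * \<bar>x $ i - y $ i\<bar>" by (simp add: abs_mult)
      then have "\<delta> \<le> \<bar>(x - y) $ i\<bar>"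
        using n by (simp add: \<delta>_def power_one_over divide_le_eq mult.commute)
      also have "\<dots> \<le> dist x y" unfolding dist_norm by (rule component_le_norm_cart)
      finally show ?thesis .
    qed
    have "F \<gamma> \<noteq> {}"
      by (rule reach_vertex(2)[OF _ \<alpha>]) (meson \<beta>(1) \<beta>' edge_reach reach_trans)
    then have "ennreal (real J / real \<nu> ^ (q + 1 + p) / (card (sign_vectors :: (int ^ 'k) set) * real \<nu>))
        \<le> hausdorff_premeasure s (\<delta> / 2) (F \<alpha>)"
      by (intro hausdorff_premeasure_ge_words[where E = E and N = "q + 1 + p + J" and \<gamma> = \<gamma>]
          compact_F s \<delta> sep WE) (auto simp: E_def)
    also have "\<dots> \<le> hausdorff_measure s (F \<alpha>)"
      by (rule hausdorff_measure_ge_premeasure) (use \<delta> in simp)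
    finally show ?thesis .
  qed
  show ?thesis
  proof (rule ccontr)
    assume "hausdorff_measure s (F \<alpha>) \<noteq> \<infinity>"
    then obtain r where r: "0 \<le> r" "hausdorff_measure s (F \<alpha>) = ennreal r"
      by (metis ennreal_cases infinity_ennreal_def)
    let ?c = "real \<nu> ^ (q + 1 + p) * (card (sign_vectors :: (int ^ 'k) set) * real \<nu>)"
    have "0 < card (sign_vectors :: (int ^ 'k) set)"
      by (rule card_sign_vectors_pos)
    then have c: "?c > 0" using \<nu> by simp
    obtain J :: nat where J: "r * ?c < real J" using reals_Archimedean2 by blast
    have "real J / ?c \<le> r" using big[of J] r by (simp add: divide_divide_eq_left)
    then show False using J c by (simp add: divide_le_eq)
  qed
qed

subsection \<open>Upper bounds\<close>

text \<open>Overlapping pieces are counted separately, which only weakens the upper bound.\<close>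

primrec path_count :: "nat \<Rightarrow> int ^ 'k \<Rightarrow> nat" where
  "path_count 0 = (\<lambda>_. 1)"
| "path_count (Suc m) = (\<lambda>\<alpha>. card (G \<alpha> \<alpha>) * path_count m \<alpha> +
     (\<Sum>\<beta>\<in>{\<beta>. edge \<alpha> \<beta> \<and> \<alpha> \<noteq> \<beta>}. card (G \<alpha> \<beta>) * path_count m \<beta>))"

lemma finite_edges: "finite {\<beta>. edge \<alpha> \<beta> \<and> \<alpha> \<noteq> \<beta>}"
  by (rule finite_subset[OF _ finite_sign_vectors]) (auto simp: structure_edge_def)

text \<open>Iterates \<open>F_decompose\<close>, each step contracting by 1 / n. The initial size is
  the crude l1 bound for the diameter of the unit cube.\<close>

lemma F_covered_by:
  assumes "\<alpha> \<in> sign_vectors"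
  shows "covered_by (F \<alpha>) (path_count m \<alpha>) (real CARD('k) * (1 / real n) ^ m)"
  using assms
proof (induction m arbitrary: \<alpha>)
  case 0
  have "dist x y \<le> CARD('k)" if "x \<in> F \<alpha>" "y \<in> F \<alpha>" for x y
  proof -
    have "dist x y \<le> (\<Sum>i\<in>UNIV. \<bar>(x - y) $ i\<bar>)" unfolding dist_norm by (rule norm_le_l1_cart)
    also have "\<dots> \<le> (\<Sum>i\<in>(UNIV :: 'k set). 1)"
    proof (rule sum_mono)
      fix i
      show "\<bar>(x - y) $ i\<bar> \<le> 1"
        using F_coord(1,2)[OF that(1), of i] F_coord(1,2)[OF that(2), of i] by simp
    qed
    finally show ?thesis by simp
  qed
  then have "diameter (F \<alpha>) \<le> CARD('k)"
    unfolding diameter_def by (auto intro!: cSUP_least)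
  then show ?case
    unfolding covered_by_def using compact_imp_bounded[OF compact_F]
    by (intro exI[of _ "{F \<alpha>}"]) auto
next
  case (Suc m)
  define f where "f g x = (1 / real n) *\<^sub>R (x + real_vec g)" for g :: "int ^ 'k" and x :: "real ^ 'k"
  let ?r = "real CARD('k) * (1 / real n) ^ m"
  have piece: "covered_by (\<Union>g\<in>G \<alpha> \<beta>. f g ` F \<beta>) (card (G \<alpha> \<beta>) * path_count m \<beta>) (1 / real n * ?r)"
    if "\<beta> \<in> sign_vectors" for \<beta>
  proof -
    have "covered_by (\<Union>g\<in>G \<alpha> \<beta>. f g ` F \<beta>) (\<Sum>g\<in>G \<alpha> \<beta>. path_count m \<beta>) (1 / real n * ?r)"
      using n by (intro covered_by_UN finite_G covered_by_image Suc.IH that)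
        (auto simp: f_def dist_norm simp flip: scaleR_diff_right)
    then show ?thesis by simp
  qed
  have "F \<alpha> \<subseteq> (\<Union>g\<in>G \<alpha> \<alpha>. f g ` F \<alpha>) \<union>
      (\<Union>\<beta>\<in>{\<beta>. edge \<alpha> \<beta> \<and> \<alpha> \<noteq> \<beta>}. \<Union>g\<in>G \<alpha> \<beta>. f g ` F \<beta>)"
  proof
    fix x assume "x \<in> F \<alpha>"
    then obtain \<beta> g y where "edge \<alpha> \<beta>" "g \<in> G \<alpha> \<beta>" "y \<in> F \<beta>" "x = f g y"
      using F_decompose[OF _ Suc.prems] unfolding f_def by metis
    then show "x \<in> (\<Union>g\<in>G \<alpha> \<alpha>. f g ` F \<alpha>) \<union>
      (\<Union>\<beta>\<in>{\<beta>. edge \<alpha> \<beta> \<and> \<alpha> \<noteq> \<beta>}. \<Union>g\<in>G \<alpha> \<beta>. f g ` F \<beta>)"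
      by (cases "\<beta> = \<alpha>") blast+
  qed
  moreover have "covered_by \<dots> (path_count (Suc m) \<alpha>) (1 / real n * ?r)"
    unfolding path_count.simps
    by (intro covered_by_Un covered_by_UN finite_edges piece Suc.prems) (auto simp: structure_edge_def)
  ultimately have "covered_by (F \<alpha>) (path_count (Suc m) \<alpha>) (1 / real n * ?r)"
    by (rule covered_by_subset[rotated])
  moreover have "1 / real n * ?r = real CARD('k) * (1 / real n) ^ Suc m" by simp
  ultimately show ?case by (simp only:)
qed

section \<open>Growth rates of path counts\<close>

text \<open>No polynomial factor is allowed; this separates finite measure at the critical exponent
  from the mere dimension bound.\<close>

definition growth :: "int ^ 'k \<Rightarrow> real \<Rightarrow> bool" where
  "growth \<alpha> \<tau> \<longleftrightarrow> (\<exists>C\<ge>0. \<forall>m. real (path_count m \<alpha>) \<le> C * \<tau> ^ m)"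

text \<open>Collects the inflow from all successors in one term, turning the count into a scalar
  linear recursion.\<close>

lemma growth_successors:
  assumes "\<And>\<beta>. edge \<alpha> \<beta> \<Longrightarrow> \<alpha> \<noteq> \<beta> \<Longrightarrow> growth \<beta> \<tau>"
  shows "\<exists>B\<ge>0. \<forall>m. real (path_count (Suc m) \<alpha>) \<le> card (G \<alpha> \<alpha>) * real (path_count m \<alpha>) + B * \<tau> ^ m"
proof -
  obtain C where C: "\<And>\<beta>. edge \<alpha> \<beta> \<and> \<alpha> \<noteq> \<beta> \<Longrightarrow> 0 \<le> C \<beta> \<and> (\<forall>m. real (path_count m \<beta>) \<le> C \<beta> * \<tau> ^ m)"
    using assms unfolding growth_def by metis
  let ?S = "{\<beta>. edge \<alpha> \<beta> \<and> \<alpha> \<noteq> \<beta>}"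
  let ?B = "\<Sum>\<beta>\<in>?S. card (G \<alpha> \<beta>) * C \<beta>"
  have "real (path_count (Suc m) \<alpha>) \<le> card (G \<alpha> \<alpha>) * real (path_count m \<alpha>) + ?B * \<tau> ^ m" for m
  proof -
    have "(\<Sum>\<beta>\<in>?S. real (card (G \<alpha> \<beta>)) * real (path_count m \<beta>)) \<le>
        (\<Sum>\<beta>\<in>?S. real (card (G \<alpha> \<beta>)) * (C \<beta> * \<tau> ^ m))"
      using C by (intro sum_mono mult_left_mono) auto
    also have "\<dots> = ?B * \<tau> ^ m" by (simp only: sum_distrib_right mult.assoc)
    finally show ?thesis by simp
  qed
  moreover have "0 \<le> ?B" using C by (intro sum_nonneg) auto
  ultimately show ?thesis by blast
qed

lemma growth_subcritical:
  fixes \<tau> :: real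
  assumes \<tau>: "card (G \<alpha> \<alpha>) < \<tau>" and "\<And>\<beta>. edge \<alpha> \<beta> \<Longrightarrow> \<alpha> \<noteq> \<beta> \<Longrightarrow> growth \<beta> \<tau>"
  shows "growth \<alpha> \<tau>"
proof -
  obtain B where B: "0 \<le> B"
    "\<And>m. real (path_count (Suc m) \<alpha>) \<le> card (G \<alpha> \<alpha>) * real (path_count m \<alpha>) + B * \<tau> ^ m"
    using growth_successors[OF assms(2)] by blast
  let ?c = "real (card (G \<alpha> \<alpha>))"
  \<comment> \<open>The quotient makes c A + B \<le> A \<tau>, which closes the induction; the
    maximum with 1 covers m = 0.\<close>
  define A where "A = max 1 (B / (\<tau> - ?c))"
  have A: "?c * A + B \<le> A * \<tau>"
  proof -
    have "B / (\<tau> - ?c) \<le> A" by (simp add: A_def)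
    then show ?thesis using \<tau> by (simp add: divide_le_eq algebra_simps)
  qed
  have \<tau>0: "0 \<le> \<tau>" using \<tau> by linarith
  have "real (path_count m \<alpha>) \<le> A * \<tau> ^ m" for m
  proof (induction m)
    case (Suc m)
    have "real (path_count (Suc m) \<alpha>) \<le> ?c * real (path_count m \<alpha>) + B * \<tau> ^ m" by (rule B)
    also have "\<dots> \<le> ?c * (A * \<tau> ^ m) + B * \<tau> ^ m" using Suc by (intro add_right_mono mult_left_mono) auto
    also have "\<dots> = (?c * A + B) * \<tau> ^ m" by (simp add: algebra_simps)
    also have "\<dots> \<le> A * \<tau> * \<tau> ^ m" using A \<tau>0 by (intro mult_right_mono) auto
    finally show ?case by (simp add: mult.assoc)
  qed (simp add: A_def)
  then show ?thesis unfolding growth_def by (intro exI[of _ A]) (simp add: A_def)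
qed

text \<open>The geometric correction term in the induction hypothesis absorbs the subcritical inflow.\<close>

lemma growth_critical:
  fixes \<rho> \<nu> :: real
  assumes \<nu>: "card (G \<alpha> \<alpha>) \<le> \<nu>" and \<rho>: "0 < \<rho>" "\<rho> < \<nu>"
    and "\<And>\<beta>. edge \<alpha> \<beta> \<Longrightarrow> \<alpha> \<noteq> \<beta> \<Longrightarrow> growth \<beta> \<rho>"
  shows "growth \<alpha> \<nu>"
proof -
  obtain B where B: "0 \<le> B"
    "\<And>m. real (path_count (Suc m) \<alpha>) \<le> card (G \<alpha> \<alpha>) * real (path_count m \<alpha>) + B * \<rho> ^ m"
    using growth_successors[OF assms(4)] by blast
  \<comment> \<open>With this \<open>D\<close> the inflow exactly restores the correction term: -
    \<nu> D + B = - D \<rho>.\<close>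
  define D where "D = B / (\<nu> - \<rho>)"
  have D: "0 \<le> D" "B = D * (\<nu> - \<rho>)" using B \<rho> by (auto simp: D_def)
  have "real (path_count m \<alpha>) \<le> (1 + D) * \<nu> ^ m - D * \<rho> ^ m" for m
  proof (induction m)
    case (Suc m)
    have "real (path_count (Suc m) \<alpha>) \<le> card (G \<alpha> \<alpha>) * real (path_count m \<alpha>) + B * \<rho> ^ m" by (rule B)
    also have "\<dots> \<le> \<nu> * real (path_count m \<alpha>) + B * \<rho> ^ m" using \<nu> by (intro add_right_mono mult_right_mono) auto
    also have "\<dots> \<le> \<nu> * ((1 + D) * \<nu> ^ m - D * \<rho> ^ m) + B * \<rho> ^ m"
      using Suc \<rho> by (intro add_right_mono mult_left_mono) auto
    also have "\<dots> = (1 + D) * \<nu> ^ Suc m - D * \<rho> ^ Suc m" by (simp add: D(2) algebra_simps)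
    finally show ?case .
  qed simp
  moreover have "(1 + D) * \<nu> ^ m - D * \<rho> ^ m \<le> (1 + D) * \<nu> ^ m" for m using D \<rho> by simp
  ultimately have "real (path_count m \<alpha>) \<le> (1 + D) * \<nu> ^ m" for m using order_trans by blast
  then show ?thesis unfolding growth_def using D by (intro exI[of _ "1 + D"]) auto
qed

text \<open>Induction on the rank, with every reachable vertex subcritical. It serves for rates
  slightly above \<nu> and for the vertices beyond a critical one.\<close>

lemma growth_reach:
  fixes \<tau> :: real
  assumes "\<And>\<beta>. reach \<alpha> \<beta> \<Longrightarrow> card (G \<beta> \<beta>) < \<tau>"
  shows "growth \<alpha> \<tau>"
  using assms
proof (induction "zeros \<alpha>" arbitrary: \<alpha> rule: less_induct)
  case less
  show ?case
  proof (rule growth_subcritical)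
    show "card (G \<alpha> \<alpha>) < \<tau>" by (rule less.prems) (simp add: structure_le_def)
    fix \<beta> assume e: "edge \<alpha> \<beta>" "\<alpha> \<noteq> \<beta>"
    show "growth \<beta> \<tau>"
      by (rule less.hyps[OF zeros_less[OF e] less.prems]) (rule reach_trans[OF edge_reach[OF e(1)]])
  qed
qed

text \<open>Past a critical vertex no further one follows, so the inflow has a strictly smaller rate
  and \<open>growth_critical\<close> applies. At any other vertex the rate \<nu> is inherited from
  the successors.\<close>

lemma growth_reach_critical:
  fixes \<nu> :: nat
  assumes "1 \<le> \<nu>" "\<And>\<beta>. reach \<alpha> \<beta> \<Longrightarrow> card (G \<beta> \<beta>) \<le> \<nu>"
    and "\<And>\<beta> \<gamma>. reach \<alpha> \<beta> \<Longrightarrow> reach \<beta> \<gamma> \<Longrightarrow> card (G \<beta> \<beta>) = \<nu> \<Longrightarrow> card (G \<gamma> \<gamma>) = \<nu> \<Longrightarrow> \<beta> = \<gamma>"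
  shows "growth \<alpha> \<nu>"
  using assms(2,3)
proof (induction "zeros \<alpha>" arbitrary: \<alpha> rule: less_induct)
  case less
  have refl: "reach \<alpha> \<alpha>" by (simp add: structure_le_def)
  show ?case
  proof (cases "card (G \<alpha> \<alpha>) = \<nu>")
    case True
    show ?thesis
    \<comment> \<open>Cardinalities are integers, so those below \<nu> are at most \<nu> - 1 and lie
      strictly below this \<rho>, which is positive as \<nu> \<ge> 1.\<close>
    proof (rule growth_critical[where \<rho> = "real \<nu> - 1 / 2"])
      fix \<beta> assume e: "edge \<alpha> \<beta>" "\<alpha> \<noteq> \<beta>"
      show "growth \<beta> (real \<nu> - 1 / 2)"
      proof (rule growth_reach)
        fix \<gamma> assume "reach \<beta> \<gamma>"
        then have r: "reach \<alpha> \<gamma>" by (rule reach_trans[OF edge_reach[OF e(1)]])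
        have "\<gamma> \<noteq> \<alpha>"
        proof
          assume "\<gamma> = \<alpha>"
          then have "zeros \<alpha> \<le> zeros \<beta>"
            using reach_zeros_le \<open>reach \<beta> \<gamma>\<close> by blast
          then show False using zeros_less[OF e] by simp
        qed
        then have "card (G \<gamma> \<gamma>) \<noteq> \<nu>" using less.prems(2)[OF refl r] True by blast
        then have "card (G \<gamma> \<gamma>) < \<nu>" using less.prems(1)[OF r] by simp
        then show "real (card (G \<gamma> \<gamma>)) < real \<nu> - 1 / 2" by linarith
      qed
    qed (use True assms(1) in auto)
  next
    case False
    show ?thesis
    proof (rule growth_subcritical)
      show "real (card (G \<alpha> \<alpha>)) < real \<nu>" using False less.prems(1)[OF refl] by simp
      fix \<beta> assume e: "edge \<alpha> \<beta>" "\<alpha> \<noteq> \<beta>"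
      show "growth \<beta> \<nu>"
        using less.prems reach_trans[OF edge_reach[OF e(1)]] by (intro less.hyps zeros_less e) blast+
    qed
  qed
qed

text \<open>The weight of the m-th cover is at most a constant times the m-th power of \<tau> / n^s:
  bounded if \<tau> \<le> n^s, tending to 0 if the inequality is strict.\<close>

lemma hausdorff_measure_le_of_growth:
  assumes \<alpha>: "\<alpha> \<in> sign_vectors" and s: "0 \<le> s" and g: "growth \<alpha> \<tau>" and \<tau>: "0 \<le> \<tau>" "\<tau> \<le> n powr s"
  shows "hausdorff_measure s (F \<alpha>) < \<infinity>"
    and "\<tau> < n powr s \<Longrightarrow> hausdorff_measure s (F \<alpha>) = 0"
proof -
  obtain C where C: "0 \<le> C" "\<And>m. real (path_count m \<alpha>) \<le> C * \<tau> ^ m"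
    using g unfolding growth_def by blast
  let ?k = "real CARD('k)"
  let ?r = "\<lambda>m. ?k * (1 / real n) ^ m"
  let ?c = "\<lambda>m. C * ?k powr s * (\<tau> / n powr s) ^ m"
  have r: "((1 / real n) ^ m) powr s = (1 / n powr s) ^ m" for m
    using n by (simp add: powr_power powr_divide power_one_over powr_realpow[symmetric] powr_powr mult.commute)
  have rs: "?r m powr s = ?k powr s * (1 / n powr s) ^ m" for m
    using powr_mult[of ?k "(1 / real n) ^ m" s] r by simp
  have le: "real (path_count m \<alpha>) * ?r m powr s \<le> ?c m" for m
  proof -
    have "real (path_count m \<alpha>) * ?r m powr s \<le> C * \<tau> ^ m * ?r m powr s"
      by (intro mult_right_mono C) simp
    also have "\<dots> = ?c m" unfolding rs by (simp add: power_divide)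
    finally show ?thesis .
  qed
  have pos: "0 < ?r m" for m using n by (simp add: zero_less_power)
  have "(\<lambda>m. ?k * (1 / real n) ^ m) \<longlonglongrightarrow> ?k * 0"
    using n by (intro tendsto_intros LIMSEQ_realpow_zero) auto
  then have lim: "?r \<longlonglongrightarrow> 0" by simp
  have "?c m \<le> C * ?k powr s" for m
  proof -
    have "(\<tau> / n powr s) ^ m \<le> 1" using \<tau> n by (intro power_le_one) auto
    then show ?thesis using C(1) by (simp add: mult_left_le)
  qed
  then have le': "real (path_count m \<alpha>) * ?r m powr s \<le> C * ?k powr s" for m
    using le order_trans by blast
  have "hausdorff_measure s (F \<alpha>) \<le> ennreal (C * ?k powr s)"
    by (rule hausdorff_measure_le_of_covers[OF s F_covered_by[OF \<alpha>] pos lim le' tendsto_const])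
  then show "hausdorff_measure s (F \<alpha>) < \<infinity>" by (simp add: le_less_trans)
  assume "\<tau> < n powr s"
  then have "?c \<longlonglongrightarrow> C * ?k powr s * 0"
    using \<tau> n by (intro tendsto_intros LIMSEQ_realpow_zero) auto
  from hausdorff_measure_le_of_covers[OF s F_covered_by[OF \<alpha>] pos lim le this]
  show "hausdorff_measure s (F \<alpha>) = 0" by simp
qed

end

section \<open>Dimension, positivity and the finiteness criterion\<close>

theorem theorem9:
  fixes n :: nat
    and D1 D2 :: "(int ^ 'k) set"
    and K1 K2 :: "(real ^ 'k) set"
    and \<alpha> :: "int ^ 'k"
  assumes "n \<ge> 2"
    and "D1 \<noteq> {}" and "D1 \<subseteq> digit_cube n"
    and "D2 \<noteq> {}" and "D2 \<subseteq> digit_cube n"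
    and "is_fractal_cube n D1 K1"
    and "is_fractal_cube n D2 K2"
    and "\<alpha> \<in> sign_vectors"
    and "F_set K1 K2 \<alpha> \<noteq> {}"
  shows "hausdorff_dim (F_set K1 K2 \<alpha>) = ereal (s_exponent n D1 D2 K1 K2 \<alpha>) \<and>
    hausdorff_measure (s_exponent n D1 D2 K1 K2 \<alpha>) (F_set K1 K2 \<alpha>) > 0 \<and>
    (hausdorff_measure (s_exponent n D1 D2 K1 K2 \<alpha>) (F_set K1 K2 \<alpha>) < \<infinity> \<longleftrightarrow>
      \<not> (\<exists>\<beta> \<gamma>. \<beta> \<noteq> \<gamma> \<and>
            structure_le n D1 D2 K1 K2 \<alpha> \<beta> \<and>
            card (G_set n D1 D2 \<beta>) = nu n D1 D2 K1 K2 \<alpha> \<and>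
            structure_le n D1 D2 K1 K2 \<alpha> \<gamma> \<and>
            card (G_set n D1 D2 \<gamma>) = nu n D1 D2 K1 K2 \<alpha> \<and>
            structure_comparable n D1 D2 K1 K2 \<beta> \<gamma>))"
proof -
  interpret fractal_cube_pair n D1 D2 K1 K2
    using assms by unfold_locales auto
  define \<nu> where "\<nu> = nu n D1 D2 K1 K2 \<alpha>"
  define s where "s = s_exponent n D1 D2 K1 K2 \<alpha>"
  have \<alpha>: "\<alpha> \<in> sign_vectors" "F \<alpha> \<noteq> {}" using assms by auto
  let ?A = "{card (G \<beta> \<beta>) | \<beta>. reach \<alpha> \<beta>}"
  have \<nu>_Max: "\<nu> = Max ?A" by (simp add: \<nu>_def nu_def G_pair_same)
  have "finite {\<beta>. reach \<alpha> \<beta>}"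
    by (rule finite_subset[OF _ finite_sign_vectors]) (use reach_vertex(1)[OF _ \<alpha>] in blast)
  then have fin: "finite ?A" by simp
  have refl: "reach \<alpha> \<alpha>" by (simp add: structure_le_def)
  have le: "card (G \<beta> \<beta>) \<le> \<nu>" if "reach \<alpha> \<beta>" for \<beta>
    unfolding \<nu>_Max using that fin by (intro Max_ge) auto
  have "\<nu> \<in> ?A" unfolding \<nu>_Max using fin refl by (intro Max_in) auto
  then obtain \<beta> where \<beta>: "reach \<alpha> \<beta>" "card (G \<beta> \<beta>) = \<nu>" by auto
  obtain \<beta>' where "reach \<alpha> \<beta>'" "G \<beta>' \<beta>' \<noteq> {}" using ex_loop[OF \<alpha>] by blast
  then have \<nu>1: "1 \<le> \<nu>" using le[of \<beta>'] finite_G[of \<beta>' \<beta>'] by (metis card_gt_0_iff less_one linorder_not_less order_trans)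
  have s0: "0 \<le> s" unfolding s_def s_exponent_def using \<nu>1 assms(1) by (simp flip: \<nu>_def)
  have ns: "n powr s = real \<nu>"
    unfolding s_def s_exponent_def using \<nu>1 assms(1) by (simp flip: \<nu>_def)
  have pos: "hausdorff_measure s (F \<alpha>) > 0"
    by (rule hausdorff_measure_pos[OF s0 ns \<alpha> \<beta>])
  have dim: "hausdorff_dim (F \<alpha>) = ereal s"
  proof (rule hausdorff_dim_eqI[OF s0 pos])
    fix t assume t: "s < t"
    \<comment> \<open>Any rate strictly between \<nu> = n^s and n^t works; this is the geometric
      mean.\<close>
    let ?\<tau> = "n powr ((s + t) / 2)"
    have st: "real \<nu> < ?\<tau>" "?\<tau> < n powr t"
      unfolding ns[symmetric] using t assms(1) by (auto intro!: powr_less_mono)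
    have "growth \<alpha> ?\<tau>"
      by (rule growth_reach) (use le st(1) in \<open>meson of_nat_mono order_le_less_trans\<close>)
    from hausdorff_measure_le_of_growth(2)[OF \<alpha>(1) _ this _ _ st(2)] show "hausdorff_measure t (F \<alpha>) = 0"
      using st s0 t by simp
  qed
  let ?P = "\<exists>\<beta> \<gamma>. \<beta> \<noteq> \<gamma> \<and> reach \<alpha> \<beta> \<and> card (G \<beta> \<beta>) = \<nu> \<and> reach \<alpha> \<gamma> \<and> card (G \<gamma> \<gamma>) = \<nu> \<and>
    structure_comparable n D1 D2 K1 K2 \<beta> \<gamma>"
  have "hausdorff_measure s (F \<alpha>) < \<infinity> \<longleftrightarrow> \<not> ?P"
  proof
    assume fin: "hausdorff_measure s (F \<alpha>) < \<infinity>"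
    \<comment> \<open>Comparability is symmetric, so it is enough to refute the case where \<gamma>
      is reached from \<beta>.\<close>
    have no: False if "reach \<alpha> \<beta>" "card (G \<beta> \<beta>) = \<nu>" "card (G \<gamma> \<gamma>) = \<nu>" "reach \<beta> \<gamma>" "\<beta> \<noteq> \<gamma>" for \<beta> \<gamma>
      using hausdorff_measure_infinite[OF s0 ns \<alpha> that(1,2) _ that(3)] that(4,5) fin
      by (auto simp: structure_le_def)
    show "\<not> ?P" unfolding structure_comparable_def using no by metis
  next
    assume "\<not> ?P"
    then have "\<beta> = \<gamma>" if "reach \<alpha> \<beta>" "reach \<beta> \<gamma>" "card (G \<beta> \<beta>) = \<nu>" "card (G \<gamma> \<gamma>) = \<nu>" for \<beta> \<gamma>
      using that reach_trans[OF that(1,2)] unfolding structure_comparable_def by blast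
    then have "growth \<alpha> \<nu>" by (intro growth_reach_critical \<nu>1 le)
    then show "hausdorff_measure s (F \<alpha>) < \<infinity>"
      by (intro hausdorff_measure_le_of_growth(1)[OF \<alpha>(1) s0]) (auto simp: ns)
  qed
  with pos dim show ?thesis by (simp add: s_def \<nu>_def G_pair_same)
qed

end
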